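(* Let $w=(w_n)_{n\ge 0}$ and $u=(u_n)_{n\ge 0}$ be sequences of positive numbers such that the weighted Hardy spaces $\mathcal{H}_w$ and $\mathcal{H}_u$ are Hilbert function spaces on the open unit disk $\mathbb{D}$. (1) If $w_n\sim u_n$, then $\mathcal{H}_w\cong\mathcal{H}_u$ (isomorphic as Hilbert function spaces). In this case the isomorphism can be chosen to be isometric if and only if there exists $c>0$ such that $\frac{w_n}{u_n}=c$ for all $n$. (2) Suppose that $\mathcal{H}_w\cong\mathcal{H}_u$ via an isomorphism of Hilbert function spaces $T:\mathcal{H}_w\to\mathcal{H}_u$ whose adjoint has the form $T^*=\alpha C_\phi$, where $\alpha\in\mathbb{C}$ and $\phi:\mathbb{D}\to\mathbb{D}$ is a bijection. Then $w_n\sim u_n$, and the isomorphism can be chosen to be isometric if and only if there exists $c>0$ such that $\frac{w_n}{u_n}=c$ for all $n$.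
   Context: For a sequence $w=(w_n)_{n\ge0}$ of positive numbers, the weighted Hardy space is $\mathcal{H}_w=\{\sum a_nz^n\in\mathbb{C}[[z]]:\sum|a_n|^2w_n<\infty\}$ with inner product $\langle f,g\rangle=\sum f_n\overline{g_n}w_n$. It is a Hilbert function space on the open unit disk $\mathbb{D}$ (i.e. its elements converge to functions on $\mathbb{D}$ and point evaluations are bounded) if and only if $\sum w_n^{-1}z^n$ has radius of convergence at least $1$; then its reproducing kernel at $s\in\mathbb{D}$ is $k_s^{\mathcal{H}_w}(z)=\sum w_n^{-1}(\overline{s}z)^n$, where $\langle f,k_s^{\mathcal{H}_w}\rangle=f(s)$. For positive sequences, $a_n\sim b_n$ means there exist $\epsilon>0$, $M>0$ with $0<\epsilon<\frac{a_n}{b_n}<M$ for all $n$. An isomorphism of Hilbert function spaces $T:\mathcal{H}_w\to\mathcal{H}_u$ is a bijective bounded linear map for which there exist a bijection $\phi:\mathbb{D}\to\mathbb{D}$ and a non-vanishing function $\lambda:\mathbb{D}\to\mathbb{C}$ with $T(k_s^{\mathcal{H}_w})=\lambda(s)k_{\phi(s)}^{\mathcal{H}_u}$ for all $s\in\mathbb{D}$. It is isometric if it is in addition an isometry of the underlying Hilbert spaces. $\mathcal{H}_w\cong\mathcal{H}_u$ means such an isomorphism exists. $C_\phi$ denotes the composition operator $C_\phi h=h\circ\phi$, so $T^*=\alpha C_\phi$ means $T^*h=\alpha\,(h\circ\phi)$ for all $h\in\mathcal{H}_u$. *)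

theory Defs
  imports "HOL-Analysis.Analysis"
begin

abbreviation unit_disk :: "complex set" where
  "unit_disk \<equiv> ball 0 1"

definition weighted_hardy :: "(nat \<Rightarrow> real) \<Rightarrow> complex fps set" where
  "weighted_hardy w = {f. summable (\<lambda>n. (cmod (fps_nth f n))\<^sup>2 * w n)}"

definition wh_inner :: "(nat \<Rightarrow> real) \<Rightarrow> complex fps \<Rightarrow> complex fps \<Rightarrow> complex" where
  "wh_inner w f g = (\<Sum>n. fps_nth f n * cnj (fps_nth g n) * complex_of_real (w n))"

definition wh_norm :: "(nat \<Rightarrow> real) \<Rightarrow> complex fps \<Rightarrow> real" where
  "wh_norm w f = sqrt (Re (wh_inner w f f))"

text \<open>The value at a point \<open>z\<close> of the function represented by a convergent power series \<open>f\<close>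
  is \<open>eval_fps f z\<close>.\<close>

definition hilbert_function_space_on_disk :: "(nat \<Rightarrow> real) \<Rightarrow> bool" where
  "hilbert_function_space_on_disk w \<longleftrightarrow>
     (\<forall>f\<in>weighted_hardy w. \<forall>z\<in>unit_disk. summable (\<lambda>n. fps_nth f n * z ^ n)) \<and>
     (\<forall>z\<in>unit_disk. \<exists>C. \<forall>f\<in>weighted_hardy w. cmod (eval_fps f z) \<le> C * wh_norm w f)"

text \<open>That this power series is the reproducing kernel at \<open>s\<close> is proved in
  \<open>wh_kernel_in_weighted_hardy\<close> and \<open>wh_kernel_reproducing\<close> below.\<close>

definition wh_kernel :: "(nat \<Rightarrow> real) \<Rightarrow> complex \<Rightarrow> complex fps" where
  "wh_kernel w s = Abs_fps (\<lambda>n. complex_of_real (inverse (w n)) * cnj s ^ n)"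

definition weights_equiv :: "(nat \<Rightarrow> real) \<Rightarrow> (nat \<Rightarrow> real) \<Rightarrow> bool" where
  "weights_equiv a b \<longleftrightarrow> (\<exists>\<epsilon>>0. \<exists>M>0. \<forall>n. \<epsilon> < a n / b n \<and> a n / b n < M)"

text \<open>Maps between weighted Hardy spaces are total functions on power series of which only the
  values on the domain space matter; multiplication by \<open>fps_const c\<close> is scalar multiplication.\<close>

definition wh_bounded_linear ::
    "(nat \<Rightarrow> real) \<Rightarrow> (nat \<Rightarrow> real) \<Rightarrow> (complex fps \<Rightarrow> complex fps) \<Rightarrow> bool" where
  "wh_bounded_linear w u T \<longleftrightarrow>
     T ` weighted_hardy w \<subseteq> weighted_hardy u \<and>
     (\<forall>f\<in>weighted_hardy w. \<forall>g\<in>weighted_hardy w. T (f + g) = T f + T g) \<and>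
     (\<forall>c. \<forall>f\<in>weighted_hardy w. T (fps_const c * f) = fps_const c * T f) \<and>
     (\<exists>C. \<forall>f\<in>weighted_hardy w. wh_norm u (T f) \<le> C * wh_norm w f)"

definition hfs_isomorphism ::
    "(nat \<Rightarrow> real) \<Rightarrow> (nat \<Rightarrow> real) \<Rightarrow> (complex fps \<Rightarrow> complex fps) \<Rightarrow> bool" where
  "hfs_isomorphism w u T \<longleftrightarrow>
     wh_bounded_linear w u T \<and>
     bij_betw T (weighted_hardy w) (weighted_hardy u) \<and>
     (\<exists>\<phi> \<mu>. bij_betw \<phi> unit_disk unit_disk \<and> (\<forall>s\<in>unit_disk. \<mu> s \<noteq> 0) \<and>
        (\<forall>s\<in>unit_disk. T (wh_kernel w s) = fps_const (\<mu> s) * wh_kernel u (\<phi> s)))"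

definition isometric_hfs_isomorphism ::
    "(nat \<Rightarrow> real) \<Rightarrow> (nat \<Rightarrow> real) \<Rightarrow> (complex fps \<Rightarrow> complex fps) \<Rightarrow> bool" where
  "isometric_hfs_isomorphism w u T \<longleftrightarrow>
     hfs_isomorphism w u T \<and> (\<forall>f\<in>weighted_hardy w. wh_norm u (T f) = wh_norm w f)"

definition hfs_isomorphic :: "(nat \<Rightarrow> real) \<Rightarrow> (nat \<Rightarrow> real) \<Rightarrow> bool" where
  "hfs_isomorphic w u \<longleftrightarrow> (\<exists>T. hfs_isomorphism w u T)"

definition is_wh_adjoint ::
    "(nat \<Rightarrow> real) \<Rightarrow> (nat \<Rightarrow> real) \<Rightarrow> (complex fps \<Rightarrow> complex fps) \<Rightarrow>
      (complex fps \<Rightarrow> complex fps) \<Rightarrow> bool" where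
  "is_wh_adjoint w u T S \<longleftrightarrow>
     S ` weighted_hardy u \<subseteq> weighted_hardy w \<and>
     (\<forall>f\<in>weighted_hardy w. \<forall>h\<in>weighted_hardy u. wh_inner u (T f) h = wh_inner w f (S h))"

text \<open>The adjoint of \<open>T\<close> is \<open>\<alpha> C\<^sub>\<phi>\<close>; the identity \<open>T\<^sup>* h = \<alpha> (h \<circ> \<phi>)\<close> is one between
  functions on the disk.\<close>

definition adjoint_is_composition ::
    "(nat \<Rightarrow> real) \<Rightarrow> (nat \<Rightarrow> real) \<Rightarrow> (complex fps \<Rightarrow> complex fps) \<Rightarrow>
      complex \<Rightarrow> (complex \<Rightarrow> complex) \<Rightarrow> bool" where
  "adjoint_is_composition w u T \<alpha> \<phi> \<longleftrightarrow>
     (\<exists>S. is_wh_adjoint w u T S \<and>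
        (\<forall>h\<in>weighted_hardy u. \<forall>z\<in>unit_disk. eval_fps (S h) z = \<alpha> * eval_fps h (\<phi> z)))"

lemma wh_kernel_in_weighted_hardy:
  assumes pos: "\<And>n. w n > 0" and hfs: "hilbert_function_space_on_disk w" and s: "s \<in> unit_disk"
  shows "wh_kernel w s \<in> weighted_hardy w"
proof -
  define a where "a n = (cmod s)^(2*n) / w n" for n
  have a0: "a n \<ge> 0" for n using pos[of n] by (simp add: a_def)
  obtain C where C: "\<And>f. f \<in> weighted_hardy w \<Longrightarrow> cmod (eval_fps f s) \<le> C * wh_norm w f"
    using hfs s unfolding hilbert_function_space_on_disk_def by blast
  have ss: "cnj s ^ n * s ^ n = complex_of_real ((cmod s)^(2*n))" for n
  proof -
    have "complex_of_real ((cmod s)^(2*n)) = (s * cnj s) ^ n"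
      by (simp only: power_mult of_real_power complex_norm_square[symmetric])
    then show ?thesis by (simp add: power_mult_distrib mult.commute)
  qed
  have bound: "(\<Sum>n<N. a n) \<le> C\<^sup>2" for N
  proof -
    define p where "p = Abs_fps (\<lambda>n. if n < N then fps_nth (wh_kernel w s) n else 0)"
    have fin: "finite {..<N}" by simp
    have pn: "fps_nth p n = (if n < N then complex_of_real (inverse (w n)) * cnj s ^ n else 0)" for n
      by (simp add: p_def wh_kernel_def)
    have pin: "p \<in> weighted_hardy w"
      unfolding weighted_hardy_def mem_Collect_eq
      by (rule summable_finite[OF fin]) (simp add: pn)
    have ev: "eval_fps p s = complex_of_real (\<Sum>n<N. a n)"
    proof -
      have "eval_fps p s = (\<Sum>n<N. fps_nth p n * s ^ n)"
        unfolding eval_fps_def by (rule suminf_finite[OF fin]) (simp add: pn)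
      also have "\<dots> = (\<Sum>n<N. complex_of_real (a n))"
      proof (rule sum.cong)
        fix n assume "n \<in> {..<N}"
        then have "fps_nth p n * s ^ n = (cnj s ^ n * s ^ n) * complex_of_real (inverse (w n))"
          by (simp add: pn)
        also have "\<dots> = complex_of_real (a n)"
          unfolding ss by (simp add: a_def divide_inverse)
        finally show "fps_nth p n * s ^ n = complex_of_real (a n)" .
      qed simp
      finally show ?thesis by simp
    qed
    have inn: "wh_inner w p p = complex_of_real (\<Sum>n<N. a n)"
    proof -
      have "wh_inner w p p = (\<Sum>n<N. fps_nth p n * cnj (fps_nth p n) * complex_of_real (w n))"
        unfolding wh_inner_def by (rule suminf_finite[OF fin]) (simp add: pn)
      also have "\<dots> = (\<Sum>n<N. complex_of_real (a n))"
      proof (rule sum.cong)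
        fix n assume "n \<in> {..<N}"
        then have "fps_nth p n * cnj (fps_nth p n) * complex_of_real (w n)
           = (cnj s ^ n * s ^ n) * complex_of_real (inverse (w n) * inverse (w n) * w n)"
          by (simp add: pn)
        also have "\<dots> = complex_of_real (a n)"
          using pos[of n] unfolding ss by (simp add: a_def divide_simps)
        finally show "fps_nth p n * cnj (fps_nth p n) * complex_of_real (w n) = complex_of_real (a n)" .
      qed simp
      finally show ?thesis by simp
    qed
    define A where "A = (\<Sum>n<N. a n)"
    have A0: "A \<ge> 0" unfolding A_def by (rule sum_nonneg) (rule a0)
    have "A \<le> C * sqrt A"
      using C[OF pin] A0 by (simp only: ev inn wh_norm_def A_def[symmetric] norm_of_real Re_complex_of_real abs_of_nonneg)
    then have "sqrt A * sqrt A \<le> C * sqrt A" using A0 by simp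
    then have "A = 0 \<or> sqrt A \<le> C"
      using A0 mult_le_cancel_right_pos[of "sqrt A"] by (metis order_le_less real_sqrt_gt_0_iff)
    then have "A \<le> C\<^sup>2" using sqrt_le_D by auto
    then show ?thesis by (simp add: A_def)
  qed
  have "summable a"
    by (rule summableI_nonneg_bounded[of a "C\<^sup>2"]) (auto intro: a0 bound)
  moreover have "(cmod (fps_nth (wh_kernel w s) n))\<^sup>2 * w n = a n" for n
  proof -
    have c: "cmod (fps_nth (wh_kernel w s) n) = inverse (w n) * cmod s ^ n"
      using pos[of n]
      by (simp only: wh_kernel_def fps_nth_Abs_fps norm_mult norm_power norm_of_real complex_mod_cnj)
        simp
    show ?thesis using pos[of n] unfolding c a_def
      by (simp add: power_mult_distrib power_even_eq power2_eq_square divide_simps)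
  qed
  ultimately show ?thesis by (simp add: weighted_hardy_def)
qed

lemma wh_kernel_reproducing:
  assumes pos: "\<And>n. w n > 0"
  shows "wh_inner w f (wh_kernel w s) = eval_fps f s"
proof -
  have "fps_nth f n * cnj (fps_nth (wh_kernel w s) n) * complex_of_real (w n) = fps_nth f n * s ^ n" for n
    using pos[of n] by (simp add: wh_kernel_def)
  then show ?thesis unfolding wh_inner_def eval_fps_def by presburger
qed

end

theory Submission
  imports Defs "HOL-Complex_Analysis.Complex_Analysis"
begin

text \<open>
  If the adjoint of \<open>T\<close> is \<open>\<alpha> C\<^sub>\<phi>\<close>, then \<open>C\<^sub>\<phi>\<close> is a bounded bijection from \<open>H\<^sub>u\<close> onto \<open>H\<^sub>w\<close>
  with bounded inverse \<open>C\<^sub>\<psi>\<close>, \<open>\<psi> = \<phi>\<^sup>-\<^sup>1\<close>, and \<open>\<phi>\<close> is holomorphic, being a quotient of the images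
  of \<open>z\<close> and \<open>1\<close>. Rotations act unitarily on both spaces, so \<open>\<phi>\<close> may be replaced by
  \<open>\<phi> \<circ> \<theta> \<circ> \<psi> \<circ> \<eta> \<circ> \<phi>\<close> for any unimodular \<open>\<eta>, \<theta>\<close>. These can be chosen such that the
  composite fixes \<open>0\<close> and hence, by the Schwarz lemma, is a rotation. Comparing the norms of \<open>z\<^sup>n\<close> and of
  its image then bounds \<open>w\<^sub>n / u\<^sub>n\<close> from both sides.

  For an isometric \<open>T\<close> the inverse is the adjoint, which is \<open>h \<mapsto> m \<cdot> (h \<circ> \<phi>)\<close> for some
  non-vanishing \<open>m\<close>. The same argument applies with all bounds equal to \<open>1\<close>, after one has
  shown that, once \<open>\<phi>\<close> is a rotation, \<open>m\<close> is constant.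
\<close>

section \<open>Hilbert space structure\<close>

locale weighted_hardy_space =
  fixes w :: "nat \<Rightarrow> real"
  assumes pos: "w n > 0"
begin

abbreviation H where "H \<equiv> weighted_hardy w"
abbreviation inner where "inner \<equiv> wh_inner w"
abbreviation nrm where "nrm \<equiv> wh_norm w"

lemma nonneg: "0 \<le> w n"
  using pos[of n] by simp

lemma summable_sq: "f \<in> H \<Longrightarrow> summable (\<lambda>n. (cmod (fps_nth f n))\<^sup>2 * w n)"
  by (simp add: weighted_hardy_def)

lemma in_H_finite:
  assumes "finite A" "\<And>n. n \<notin> A \<Longrightarrow> fps_nth f n = 0"
  shows "f \<in> H"
  unfolding weighted_hardy_def mem_Collect_eq
  by (rule summable_finite[OF assms(1)]) (simp add: assms(2))

lemma zero_in_H: "0 \<in> H"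
  by (rule in_H_finite[of "{}"]) auto

lemma scale_in_H: "f \<in> H \<Longrightarrow> fps_const c * f \<in> H"
  unfolding weighted_hardy_def
  by (simp add: norm_mult power_mult_distrib mult.assoc summable_mult)

lemma add_in_H:
  assumes "f \<in> H" "g \<in> H"
  shows "f + g \<in> H"
  unfolding weighted_hardy_def mem_Collect_eq
proof (rule summable_comparison_test', rule summable_add)
  show "summable (\<lambda>n. 2 * ((cmod (fps_nth f n))\<^sup>2 * w n))"
    and "summable (\<lambda>n. 2 * ((cmod (fps_nth g n))\<^sup>2 * w n))"
    using assms by (auto intro!: summable_mult summable_sq)
  fix n :: nat
  let ?a = "fps_nth f n" and ?b = "fps_nth g n"
  have "(cmod (?a + ?b))\<^sup>2 \<le> (cmod ?a + cmod ?b)\<^sup>2"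
    by (intro power_mono norm_triangle_ineq) auto
  also have "\<dots> \<le> 2 * (cmod ?a)\<^sup>2 + 2 * (cmod ?b)\<^sup>2"
    using sum_squares_bound[of "cmod ?a" "cmod ?b"] by (simp add: power2_sum)
  finally have "(cmod (?a + ?b))\<^sup>2 * w n \<le> (2 * (cmod ?a)\<^sup>2 + 2 * (cmod ?b)\<^sup>2) * w n"
    by (rule mult_right_mono) (rule nonneg)
  then show "norm ((cmod (fps_nth (f + g) n))\<^sup>2 * w n)
      \<le> 2 * ((cmod ?a)\<^sup>2 * w n) + 2 * ((cmod ?b)\<^sup>2 * w n)"
    using nonneg[of n] by (simp add: abs_mult algebra_simps)
qed

lemma diff_eq_add: "f - g = f + fps_const (- 1) * (g :: complex fps)"
  by (rule fps_ext) simp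

lemma diff_in_H: "f \<in> H \<Longrightarrow> g \<in> H \<Longrightarrow> f - g \<in> H"
  unfolding diff_eq_add by (intro add_in_H scale_in_H)

lemma inner_self:
  assumes "f \<in> H"
  shows "inner f f = complex_of_real (\<Sum>n. (cmod (fps_nth f n))\<^sup>2 * w n)"
proof -
  have "inner f f = (\<Sum>n. complex_of_real ((cmod (fps_nth f n))\<^sup>2 * w n))"
    unfolding wh_inner_def by (simp add: complex_norm_square[symmetric])
  then show ?thesis
    by (simp only: suminf_of_real[OF summable_sq[OF assms]])
qed

lemma suminf_sq_nonneg: "f \<in> H \<Longrightarrow> 0 \<le> (\<Sum>n. (cmod (fps_nth f n))\<^sup>2 * w n)"
  by (intro suminf_nonneg summable_sq) (simp_all add: nonneg)

lemma norm_sq: "f \<in> H \<Longrightarrow> (nrm f)\<^sup>2 = (\<Sum>n. (cmod (fps_nth f n))\<^sup>2 * w n)"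
  by (simp add: wh_norm_def inner_self suminf_sq_nonneg)

lemma norm_nonneg: "f \<in> H \<Longrightarrow> 0 \<le> nrm f"
  by (simp add: wh_norm_def inner_self suminf_sq_nonneg)

lemma inner_self_norm: "f \<in> H \<Longrightarrow> inner f f = complex_of_real ((nrm f)\<^sup>2)"
  by (simp only: norm_sq inner_self)

lemma partial_sum_le:
  assumes "f \<in> H" "finite A"
  shows "(\<Sum>n\<in>A. (cmod (fps_nth f n))\<^sup>2 * w n) \<le> (nrm f)\<^sup>2"
  unfolding norm_sq[OF assms(1)]
  by (rule sum_le_suminf) (use assms in \<open>simp_all add: summable_sq nonneg\<close>)

lemma coeff_le:
  assumes "f \<in> H"
  shows "cmod (fps_nth f n) * sqrt (w n) \<le> nrm f"
proof (rule power2_le_imp_le)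
  show "(cmod (fps_nth f n) * sqrt (w n))\<^sup>2 \<le> (nrm f)\<^sup>2"
    using partial_sum_le[OF assms, of "{n}"] by (simp add: power_mult_distrib nonneg)
qed (rule norm_nonneg[OF assms])

text \<open>\<open>wh_norm\<close> is an infinite sum and carries information only for members of
  \<open>H\<close>. Uniformly bounded partial sums settle membership first and then the norm, which
  suits limits built coefficient by coefficient.\<close>

lemma norm_leI:
  assumes "0 \<le> B" "\<And>N. (\<Sum>n<N. (cmod (fps_nth f n))\<^sup>2 * w n) \<le> B\<^sup>2"
  shows "f \<in> H" "nrm f \<le> B"
proof -
  show f: "f \<in> H"
    unfolding weighted_hardy_def mem_Collect_eq
    by (rule summableI_nonneg_bounded[of _ "B\<^sup>2"]) (auto simp: nonneg assms)
  have "(nrm f)\<^sup>2 \<le> B\<^sup>2"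
    unfolding norm_sq[OF f] by (rule suminf_le_const[OF summable_sq[OF f] assms(2)])
  then show "nrm f \<le> B" using assms(1) power2_le_imp_le by blast
qed

lemma norm_monom: "nrm (fps_const c * fps_X ^ k) = cmod c * sqrt (w k)"
proof -
  let ?f = "fps_const c * fps_X ^ k"
  have f: "?f \<in> H" by (rule in_H_finite[of "{k}"]) auto
  have "(nrm ?f)\<^sup>2 = (\<Sum>n\<in>{k}. (cmod (fps_nth ?f n))\<^sup>2 * w n)"
    unfolding norm_sq[OF f] by (rule suminf_finite) auto
  then have "(nrm ?f)\<^sup>2 = (cmod c * sqrt (w k))\<^sup>2"
    by (simp add: power_mult_distrib nonneg)
  then show ?thesis
    by (rule power2_eq_imp_eq) (simp_all add: norm_nonneg[OF f] nonneg)
qed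

lemma monom_in_H: "fps_const c * fps_X ^ k \<in> H"
  by (rule in_H_finite[of "{k}"]) auto

text \<open>Splitting the weight as \<open>sqrt (w n) * sqrt (w n)\<close> reduces this to
  Cauchy-Schwarz for finite sums. Absolute convergence of the inner product and \<open>CS\<close>
  follow by letting \<open>N\<close> grow.\<close>

lemma partial_CS:
  assumes "f \<in> H" "g \<in> H"
  shows "(\<Sum>n<N. cmod (fps_nth f n * cnj (fps_nth g n) * complex_of_real (w n))) \<le> nrm f * nrm g"
proof -
  have L: "L2_set (\<lambda>n. cmod (fps_nth h n) * sqrt (w n)) {..<N} \<le> nrm h" if "h \<in> H" for h
    unfolding L2_set_def
    using partial_sum_le[OF that, of "{..<N}"] norm_nonneg[OF that]
    by (intro real_le_lsqrt) (auto simp: power_mult_distrib nonneg intro!: sum_nonneg)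
  have "(\<Sum>n<N. cmod (fps_nth f n * cnj (fps_nth g n) * complex_of_real (w n)))
      = (\<Sum>n<N. \<bar>cmod (fps_nth f n) * sqrt (w n)\<bar> * \<bar>cmod (fps_nth g n) * sqrt (w n)\<bar>)"
    using nonneg by (intro sum.cong) (auto simp: norm_mult abs_mult)
  also have "\<dots> \<le> nrm f * nrm g"
    by (rule order_trans[OF L2_set_mult_ineq mult_mono])
      (auto intro: L assms norm_nonneg L2_set_nonneg)
  finally show ?thesis .
qed

lemma inner_abs_summable:
  assumes "f \<in> H" "g \<in> H"
  shows "summable (\<lambda>n. cmod (fps_nth f n * cnj (fps_nth g n) * complex_of_real (w n)))"
  by (rule summableI_nonneg_bounded[of _ "nrm f * nrm g"]) (auto simp: partial_CS[OF assms])

lemma inner_summable: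
  "f \<in> H \<Longrightarrow> g \<in> H \<Longrightarrow> summable (\<lambda>n. fps_nth f n * cnj (fps_nth g n) * complex_of_real (w n))"
  by (rule summable_norm_cancel) (rule inner_abs_summable)

lemma CS:
  assumes "f \<in> H" "g \<in> H"
  shows "cmod (inner f g) \<le> nrm f * nrm g"
proof -
  have "cmod (inner f g) \<le> (\<Sum>n. cmod (fps_nth f n * cnj (fps_nth g n) * complex_of_real (w n)))"
    unfolding wh_inner_def by (rule summable_norm) (rule inner_abs_summable[OF assms])
  also have "\<dots> \<le> nrm f * nrm g"
    by (intro suminf_le_const inner_abs_summable partial_CS assms)
  finally show ?thesis .
qed

section \<open>Sesquilinearity of the inner product and properties of the norm\<close>

lemma inner_cnj:
  assumes "f \<in> H" "g \<in> H"
  shows "inner g f = cnj (inner f g)"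
proof -
  have "(\<lambda>n. cnj (fps_nth f n * cnj (fps_nth g n) * complex_of_real (w n))) sums cnj (inner f g)"
    unfolding sums_cnj wh_inner_def by (rule summable_sums) (rule inner_summable[OF assms])
  then have "inner g f = cnj (inner f g)"
    unfolding wh_inner_def[of w g f] by (intro sums_unique[symmetric]) (simp add: mult.commute)
  then show ?thesis .
qed

lemma inner_add_left:
  assumes "f \<in> H" "g \<in> H" "h \<in> H"
  shows "inner (f + g) h = inner f h + inner g h"
  unfolding wh_inner_def using assms
  by (subst suminf_add) (auto simp: inner_summable ring_distribs)

lemma inner_scale_left:
  assumes "f \<in> H" "h \<in> H"
  shows "inner (fps_const c * f) h = c * inner f h"
  unfolding wh_inner_def using assms
  by (subst suminf_mult[symmetric, OF inner_summable]) (auto simp: mult.assoc)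

lemma inner_diff_left:
  assumes "f \<in> H" "g \<in> H" "h \<in> H"
  shows "inner (f - g) h = inner f h - inner g h"
  unfolding diff_eq_add[of f g] using assms
  by (simp only: inner_add_left inner_scale_left scale_in_H) simp

lemma inner_add_right:
  assumes "f \<in> H" "g \<in> H" "h \<in> H"
  shows "inner h (f + g) = inner h f + inner h g"
  using inner_add_left[OF assms] inner_cnj[of "f + g" h] inner_cnj[of f h] inner_cnj[of g h] assms
  by (simp add: add_in_H)

lemma inner_scale_right:
  assumes "f \<in> H" "h \<in> H"
  shows "inner h (fps_const c * f) = cnj c * inner h f"
  using inner_scale_left[OF assms] inner_cnj[of "fps_const c * f" h] inner_cnj[of f h] assms
  by (simp add: scale_in_H)

lemma inner_diff_right:
  assumes "f \<in> H" "g \<in> H" "h \<in> H"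
  shows "inner h (f - g) = inner h f - inner h g"
  unfolding diff_eq_add[of f g] using assms
  by (simp only: inner_add_right inner_scale_right scale_in_H) simp

lemma norm_scale: "f \<in> H \<Longrightarrow> nrm (fps_const c * f) = cmod c * nrm f"
proof -
  assume f: "f \<in> H"
  have "inner (fps_const c * f) (fps_const c * f) = c * cnj c * inner f f"
    using f by (simp add: inner_scale_left inner_scale_right scale_in_H)
  then have "complex_of_real ((nrm (fps_const c * f))\<^sup>2) = complex_of_real ((cmod c * nrm f)\<^sup>2)"
    using f scale_in_H[OF f]
    by (simp only: inner_self_norm complex_norm_square[symmetric] power_mult_distrib of_real_mult)
  then have "(nrm (fps_const c * f))\<^sup>2 = (cmod c * nrm f)\<^sup>2"
    by (simp only: of_real_eq_iff)
  then show ?thesis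
    by (rule power2_eq_imp_eq) (simp_all add: norm_nonneg f scale_in_H)
qed

lemma norm_add_sq:
  assumes "f \<in> H" "g \<in> H"
  shows "(nrm (f + g))\<^sup>2 = (nrm f)\<^sup>2 + (nrm g)\<^sup>2 + 2 * Re (inner f g)"
proof -
  have "inner (f + g) (f + g) = inner f f + inner g g + (inner f g + cnj (inner f g))"
    using assms by (simp add: inner_add_left inner_add_right add_in_H inner_cnj[of f g])
  then have "Re (inner (f + g) (f + g)) = Re (inner f f + inner g g + (inner f g + cnj (inner f g)))"
    by simp
  then show ?thesis using assms by (simp add: inner_self_norm add_in_H)
qed

lemma norm_triangle:
  assumes "f \<in> H" "g \<in> H"
  shows "nrm (f + g) \<le> nrm f + nrm g"
proof (rule power2_le_imp_le)
  have "Re (inner f g) \<le> nrm f * nrm g"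
    using CS[OF assms] complex_Re_le_cmod order_trans by blast
  then show "(nrm (f + g))\<^sup>2 \<le> (nrm f + nrm g)\<^sup>2"
    by (simp add: norm_add_sq[OF assms] power2_sum)
qed (simp add: assms norm_nonneg)

lemma norm_diff_triangle:
  assumes "f \<in> H" "g \<in> H" "h \<in> H"
  shows "nrm (f - h) \<le> nrm (f - g) + nrm (g - h)"
  using norm_triangle[of "f - g" "g - h"] assms by (simp add: diff_in_H)

lemma norm_eq_0D: "f \<in> H \<Longrightarrow> nrm f = 0 \<Longrightarrow> f = 0"
proof (rule fps_ext)
  fix n assume "f \<in> H" "nrm f = 0"
  then have "cmod (fps_nth f n) * sqrt (w n) \<le> 0" using coeff_le[of f n] by simp
  then show "fps_nth f n = fps_nth 0 n" using pos[of n] by (simp add: mult_le_0_iff)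
qed

lemma norm_zero: "nrm 0 = 0"
  by (simp add: wh_norm_def wh_inner_def)

text \<open>Completeness for sequences with geometrically decaying steps. The explicit error bound
  matters: \<open>S_bounded_below\<close> compares it with the size of a hump, and
  \<open>S_surj\<close> lets it tend to zero.\<close>

lemma geometric_limit:
  assumes x: "\<And>n. x n \<in> H" and q: "0 \<le> q" "q < 1"
    and step: "\<And>n. nrm (x (Suc n) - x n) \<le> C * q ^ n"
  obtains y where "y \<in> H" "\<And>n. nrm (y - x n) \<le> C * q ^ n / (1 - q)"
proof -
  have C0: "0 \<le> C" using step[of 0] norm_nonneg[OF diff_in_H[OF x[of "Suc 0"] x[of 0]]] by simp
  have geo: "nrm (x (n + k) - x n) \<le> C * q ^ n / (1 - q)" for n k
  proof -
    have "nrm (x (n + k) - x n) \<le> C * q ^ n * (\<Sum>i<k. q ^ i)"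
    proof (induction k)
      case 0 show ?case by (simp add: norm_zero)
    next
      case (Suc k)
      have "nrm (x (n + Suc k) - x n) \<le> nrm (x (Suc (n + k)) - x (n + k)) + nrm (x (n + k) - x n)"
        using norm_diff_triangle[OF x x x, of "n + Suc k" n "n + k"] by simp
      also have "\<dots> \<le> C * q ^ (n + k) + C * q ^ n * (\<Sum>i<k. q ^ i)"
        using Suc step[of "n + k"] by (rule add_mono[rotated])
      finally show ?case by (simp add: algebra_simps power_add)
    qed
    also have "\<dots> \<le> C * q ^ n * (1 / (1 - q))"
    proof (rule mult_left_mono)
      have "(\<Sum>i<k. q ^ i) = (1 - q ^ k) / (1 - q)" using q sum_gp_strict[of q k] by simp
      also have "\<dots> \<le> 1 / (1 - q)" using q by (intro divide_right_mono) auto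
      finally show "(\<Sum>i<k. q ^ i) \<le> 1 / (1 - q)" .
    qed (use C0 q in simp)
    finally show ?thesis by simp
  qed
  have sw: "sqrt (w k) > 0" for k using pos by simp
  \<comment> \<open>Since \<open>w k\<close> is positive, \<open>coeff_le\<close> makes each
    coefficient functional bounded, so the coefficients converge separately.\<close>
  have "\<exists>l. (\<lambda>n. fps_nth (x n) k) \<longlonglongrightarrow> l" for k
  proof -
    have "Cauchy (\<lambda>n. fps_nth (x n) k)"
    proof (rule CauchyI')
      fix e :: real assume "e > 0"
      have "(\<lambda>n. C * q ^ n / (1 - q)) \<longlonglongrightarrow> C * 0 / (1 - q)"
        using q by (intro tendsto_intros LIMSEQ_power_zero) auto
      moreover have "e * sqrt (w k) > 0" using \<open>e > 0\<close> sw by simp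
      ultimately have "eventually (\<lambda>n. C * q ^ n / (1 - q) < e * sqrt (w k)) sequentially"
        by (intro order_tendstoD) auto
      then obtain M where M: "\<And>n. n \<ge> M \<Longrightarrow> C * q ^ n / (1 - q) < e * sqrt (w k)"
        by (auto simp: eventually_sequentially)
      show "\<exists>M. \<forall>m\<ge>M. \<forall>n>m. dist (fps_nth (x m) k) (fps_nth (x n) k) < e"
      proof (intro exI allI impI)
        fix m n assume "M \<le> m" "m < n"
        have "cmod (fps_nth (x n - x m) k) * sqrt (w k) \<le> nrm (x n - x m)"
          by (intro coeff_le diff_in_H x)
        also have "\<dots> < e * sqrt (w k)"
          using geo[of m "n - m"] M[OF \<open>M \<le> m\<close>] \<open>m < n\<close> by simp
        finally show "dist (fps_nth (x m) k) (fps_nth (x n) k) < e"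
          using sw by (simp add: dist_norm norm_minus_commute)
      qed
    qed
    then show ?thesis by (simp add: Cauchy_convergent_iff convergent_def)
  qed
  then obtain l where l: "\<And>k. (\<lambda>n. fps_nth (x n) k) \<longlonglongrightarrow> l k" by metis
  define y where "y = Abs_fps l"
  \<comment> \<open>As in Fatou's lemma, finite sections of \<open>x m - x n\<close> are estimated
    first, and only then \<open>m\<close> tends to infinity.\<close>
  have part: "(\<Sum>k<N. (cmod (fps_nth (y - x n) k))\<^sup>2 * w k) \<le> (C * q ^ n / (1 - q))\<^sup>2" for N n
  proof (rule LIMSEQ_le_const2)
    show "(\<lambda>m. \<Sum>k<N. (cmod (fps_nth (x m) k - fps_nth (x n) k))\<^sup>2 * w k)
        \<longlonglongrightarrow> (\<Sum>k<N. (cmod (fps_nth (y - x n) k))\<^sup>2 * w k)"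
      by (auto simp: y_def intro!: tendsto_intros l)
    have "(\<Sum>k<N. (cmod (fps_nth (x m) k - fps_nth (x n) k))\<^sup>2 * w k) \<le> (C * q ^ n / (1 - q))\<^sup>2"
      if "m \<ge> n" for m
    proof -
      have "(\<Sum>k<N. (cmod (fps_nth (x m - x n) k))\<^sup>2 * w k) \<le> (nrm (x m - x n))\<^sup>2"
        by (intro partial_sum_le diff_in_H x) simp
      also have "\<dots> \<le> (C * q ^ n / (1 - q))\<^sup>2"
        using geo[of n "m - n"] that norm_nonneg[OF diff_in_H[OF x x]] by (intro power_mono) auto
      finally show ?thesis by simp
    qed
    then show "\<exists>M. \<forall>m\<ge>M. (\<Sum>k<N. (cmod (fps_nth (x m) k - fps_nth (x n) k))\<^sup>2 * w k)
        \<le> (C * q ^ n / (1 - q))\<^sup>2" by blast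
  qed
  have B0: "0 \<le> C * q ^ n / (1 - q)" for n using C0 q by simp
  have d: "y - x n \<in> H" "nrm (y - x n) \<le> C * q ^ n / (1 - q)" for n
    using norm_leI[OF B0 part] by blast+
  have "y \<in> H" using add_in_H[OF d(1)[of 0] x[of 0]] by simp
  then show ?thesis using that d(2) by blast
qed

end

text \<open>An adjoint is known only through inner products; testing with \<open>a - b\<close> turns
  identities between those into identities between vectors, as in \<open>S_add\<close> and
  \<open>S_scale\<close>.\<close>

lemma (in weighted_hardy_space) eqI_inner:
  assumes "a \<in> H" "b \<in> H" "\<And>f. f \<in> H \<Longrightarrow> inner f a = inner f b"
  shows "a = b"
proof -
  have d: "a - b \<in> H" using assms by (simp add: diff_in_H)
  have "inner (a - b) (a - b) = 0"
    using assms(3)[OF d] inner_diff_right[OF assms(1,2) d] by simp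
  then have "nrm (a - b) = 0" using inner_self_norm[OF d] by simp
  then show ?thesis using norm_eq_0D[OF d] by simp
qed

section \<open>Adjoints of bounded bijections: lower bound and surjectivity\<close>

locale adjoint_bijection =
  W: weighted_hardy_space w + U: weighted_hardy_space u for w u :: "nat \<Rightarrow> real" +
  fixes T S :: "complex fps \<Rightarrow> complex fps"
  assumes lin: "wh_bounded_linear w u T"
    and bij: "bij_betw T (weighted_hardy w) (weighted_hardy u)"
    and adj: "is_wh_adjoint w u T S"
begin

lemma T_in: "f \<in> W.H \<Longrightarrow> T f \<in> U.H"
  using lin by (auto simp: wh_bounded_linear_def)

lemma S_in: "h \<in> U.H \<Longrightarrow> S h \<in> W.H"
  using adj by (auto simp: is_wh_adjoint_def)

lemma T_add: "f \<in> W.H \<Longrightarrow> g \<in> W.H \<Longrightarrow> T (f + g) = T f + T g"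
  using lin by (auto simp: wh_bounded_linear_def)

lemma T_scale: "f \<in> W.H \<Longrightarrow> T (fps_const c * f) = fps_const c * T f"
  using lin by (auto simp: wh_bounded_linear_def)

lemma T_diff: "f \<in> W.H \<Longrightarrow> g \<in> W.H \<Longrightarrow> T (f - g) = T f - T g"
  by (simp only: W.diff_eq_add T_add T_scale W.scale_in_H)

lemma adjoint: "f \<in> W.H \<Longrightarrow> h \<in> U.H \<Longrightarrow> U.inner (T f) h = W.inner f (S h)"
  using adj by (auto simp: is_wh_adjoint_def)

lemma S_add: "h \<in> U.H \<Longrightarrow> k \<in> U.H \<Longrightarrow> S (h + k) = S h + S k"
  by (rule W.eqI_inner)
    (simp_all add: S_in U.add_in_H W.add_in_H W.inner_add_right U.inner_add_right T_in
      flip: adjoint)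

lemma S_scale: "h \<in> U.H \<Longrightarrow> S (fps_const c * h) = fps_const c * S h"
  by (rule W.eqI_inner)
    (simp_all add: S_in U.scale_in_H W.scale_in_H W.inner_scale_right U.inner_scale_right T_in
      flip: adjoint)

lemma S_diff: "h \<in> U.H \<Longrightarrow> k \<in> U.H \<Longrightarrow> S (h - k) = S h - S k"
  by (simp only: U.diff_eq_add S_add S_scale U.scale_in_H)

lemma bounded_T:
  obtains C where "C > 0" "\<And>f. f \<in> W.H \<Longrightarrow> U.nrm (T f) \<le> C * W.nrm f"
proof -
  obtain C where C: "\<And>f. f \<in> W.H \<Longrightarrow> U.nrm (T f) \<le> C * W.nrm f"
    using lin unfolding wh_bounded_linear_def by blast
  have "U.nrm (T f) \<le> (\<bar>C\<bar> + 1) * W.nrm f" if "f \<in> W.H" for f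
    using C[OF that] mult_right_mono[OF _ W.norm_nonneg[OF that], of C "\<bar>C\<bar> + 1"] by linarith
  then show ?thesis by (intro that[of "\<bar>C\<bar> + 1"]) auto
qed

lemma norm_S_sq:
  assumes "h \<in> U.H"
  shows "U.inner (T (S h)) h = complex_of_real ((W.nrm (S h))\<^sup>2)"
  using adjoint[OF S_in[OF assms] assms] W.inner_self_norm[OF S_in[OF assms]] by simp

text \<open>From <T S h, h> = ||S h||^2 and Cauchy-Schwarz, ||S h||^2 <= C ||S h|| ||h||; dividing
  by ||S h|| leaves the bound of \<open>T\<close>.\<close>

lemma bounded_S:
  obtains C where "C > 0" "\<And>h. h \<in> U.H \<Longrightarrow> W.nrm (S h) \<le> C * U.nrm h"
proof -
  obtain C where C: "C > 0" "\<And>f. f \<in> W.H \<Longrightarrow> U.nrm (T f) \<le> C * W.nrm f"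
    by (rule bounded_T) blast
  have "W.nrm (S h) \<le> C * U.nrm h" if h: "h \<in> U.H" for h
  proof (cases "W.nrm (S h) = 0")
    case True
    then show ?thesis using C(1) U.norm_nonneg[OF h] by simp
  next
    case False
    then have p: "W.nrm (S h) > 0" using W.norm_nonneg[OF S_in[OF h]] by simp
    have "(W.nrm (S h))\<^sup>2 = cmod (U.inner (T (S h)) h)"
      by (simp add: norm_S_sq[OF h] norm_power)
    also have "\<dots> \<le> U.nrm (T (S h)) * U.nrm h"
      by (intro U.CS T_in S_in h)
    also have "\<dots> \<le> (C * W.nrm (S h)) * U.nrm h"
      by (intro mult_right_mono C(2) S_in h U.norm_nonneg)
    finally have "W.nrm (S h) * W.nrm (S h) \<le> W.nrm (S h) * (C * U.nrm h)"
      by (simp add: power2_eq_square mult.assoc mult.left_commute)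
    then show ?thesis using p by (rule mult_left_le_imp_le)
  qed
  then show ?thesis using C(1) that by blast
qed

text \<open>A gliding hump argument: otherwise there are unit vectors \<open>e\<^sub>n\<close> with
  \<open>\<parallel>S e\<^sub>n\<parallel> \<le> 3\<^sup>-\<^sup>n / (n + 1)\<close>, and a sum \<open>y = \<Sum>\<plusminus>3\<^sup>-\<^sup>n e\<^sub>n\<close> with suitably chosen signs
  satisfies \<open>\<bar>\<langle>y, e\<^sub>n\<rangle>\<bar> \<ge> 3\<^sup>-\<^sup>n / 2\<close>, which is incompatible with \<open>y = T f\<close>.\<close>

lemma S_bounded_below:
  "\<exists>c>0. \<forall>h\<in>U.H. c * U.nrm h \<le> W.nrm (S h)"
proof (rule ccontr)
  assume "\<not> ?thesis"
  then have neg: "\<exists>h\<in>U.H. W.nrm (S h) < c * U.nrm h" if "c > 0" for c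
    using that by (meson not_le)
  have "\<exists>e\<in>U.H. U.nrm e = 1 \<and> W.nrm (S e) \<le> (1/3)^n / real (n + 1)" for n
  proof -
    obtain h where h: "h \<in> U.H" "W.nrm (S h) < ((1/3)^n / real (n + 1)) * U.nrm h"
      using neg[of "(1/3)^n / real (n + 1)"] by auto
    then have p: "U.nrm h > 0"
      using W.norm_nonneg[OF S_in[OF h(1)]] U.norm_nonneg[OF h(1)]
      by (cases "U.nrm h = 0") auto
    let ?e = "fps_const (complex_of_real (1 / U.nrm h)) * h"
    have "U.nrm ?e = 1" unfolding U.norm_scale[OF h(1)] using p by (simp add: norm_divide)
    moreover have "W.nrm (S ?e) \<le> (1/3)^n / real (n + 1)"
      unfolding S_scale[OF h(1)] W.norm_scale[OF S_in[OF h(1)]] using p h(2)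
      by (simp add: norm_divide pos_divide_le_eq)
    ultimately show ?thesis using U.scale_in_H[OF h(1)] by blast
  qed
  then obtain e where e: "\<And>n. e n \<in> U.H" "\<And>n. U.nrm (e n) = 1"
    "\<And>n. W.nrm (S (e n)) \<le> (1/3)^n / real (n + 1)"
    by metis
  let ?r = "\<lambda>n::nat. complex_of_real ((1/3)^n)"
  \<comment> \<open>The inner products for the two signs differ by 2 * 3^-n, so at least one has
    modulus at least 3^-n; that sign is taken.\<close>
  define next_x where "next_x n x =
    (if cmod (U.inner (x + fps_const (?r n) * e n) (e n)) \<ge> (1/3)^n
     then x + fps_const (?r n) * e n else x + fps_const (- ?r n) * e n)" for n x
  define x where "x = rec_nat 0 next_x"
  have x_simps: "x 0 = 0" "\<And>n. x (Suc n) = next_x n (x n)" by (simp_all add: x_def)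
  have x_in: "x n \<in> U.H" for n
    by (induction n) (auto simp: x_simps next_x_def U.zero_in_H e intro!: U.add_in_H U.scale_in_H)
  have step: "U.nrm (x (Suc n) - x n) \<le> 1 * (1/3)^n" for n
  proof -
    have "x (Suc n) - x n = fps_const (?r n) * e n \<or> x (Suc n) - x n = fps_const (- ?r n) * e n"
      by (simp add: x_simps next_x_def)
    then show ?thesis using U.norm_scale[OF e(1)[of n], of "?r n"] U.norm_scale[OF e(1)[of n], of "- ?r n"]
      by (auto simp: e norm_power norm_divide)
  qed
  have hump: "cmod (U.inner (x (Suc n)) (e n)) \<ge> (1/3)^n" for n
  proof -
    let ?a = "U.inner (x n) (e n)"
    have ee: "U.inner (e n) (e n) = 1" using U.inner_self_norm[OF e(1)] by (simp add: e)
    have i: "U.inner (x n + fps_const c * e n) (e n) = ?a + c" for c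
      using e(1) x_in by (simp add: U.inner_add_left U.inner_scale_left U.scale_in_H ee)
    have "2 * (1/3)^n = cmod ((?a + ?r n) - (?a + - ?r n))"
      by (simp add: norm_mult norm_power norm_divide flip: mult_2)
    also have "\<dots> \<le> cmod (?a + ?r n) + cmod (?a + - ?r n)" by (rule norm_triangle_ineq4)
    finally show ?thesis unfolding x_simps next_x_def i by (auto simp: i)
  qed
  \<comment> \<open>All steps after \<open>Suc n\<close> together move the limit by at most 3^-(n+1)
    / (1 - 1/3) = 3^-n / 2, half the hump at \<open>n\<close>.\<close>
  obtain y where y: "y \<in> U.H" "\<And>n. U.nrm (y - x n) \<le> 1 * (1/3)^n / (1 - 1/3)"
    by (rule U.geometric_limit[of x "1/3" 1]) (use x_in step in auto)
  obtain f where f: "f \<in> W.H" "T f = y"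
    using bij_betw_imp_surj_on[OF bij] y(1) by (metis imageE)
  \<comment> \<open>As y = T f, the modulus of <y, e n> = <f, S (e n)> is at most ||f|| 3^-n / (n +
    1); this index makes it smaller than 3^-n / 2.\<close>
  obtain n :: nat where n: "2 * W.nrm f < real n" using reals_Archimedean2 by blast
  have "(1/3)^n \<le> cmod (U.inner (x (Suc n)) (e n))" by (rule hump)
  also have "U.inner (x (Suc n)) (e n) = U.inner y (e n) - U.inner (y - x (Suc n)) (e n)"
    using U.inner_diff_left[OF y(1) x_in e(1)] by simp
  also have "cmod \<dots> \<le> cmod (U.inner y (e n)) + cmod (U.inner (y - x (Suc n)) (e n))"
    by (rule norm_triangle_ineq4)
  also have "\<dots> \<le> W.nrm f * ((1/3)^n / real (n + 1)) + (1/3)^n / 2"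
  proof (rule add_mono)
    have "cmod (U.inner y (e n)) \<le> W.nrm f * W.nrm (S (e n))"
      using adjoint[OF f(1) e(1)[of n]] W.CS[OF f(1) S_in[OF e(1)]] f(2) by simp
    also have "\<dots> \<le> W.nrm f * ((1/3)^n / real (n + 1))"
      by (intro mult_left_mono e W.norm_nonneg f)
    finally show "cmod (U.inner y (e n)) \<le> W.nrm f * ((1/3)^n / real (n + 1))" .
    show "cmod (U.inner (y - x (Suc n)) (e n)) \<le> (1/3)^n / 2"
      using U.CS[OF U.diff_in_H[OF y(1) x_in] e(1)[of n], of "Suc n"] y(2)[of "Suc n"] e(2)[of n]
      by simp
  qed
  finally have "(1/3)^n * 1 \<le> (1/3)^n * (W.nrm f / real (n + 1) + 1/2)"
    by (simp add: algebra_simps)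
  then have "1 \<le> W.nrm f / real (n + 1) + 1/2"
    by (rule mult_left_le_imp_le) simp
  then show False using n by (simp add: field_simps)
qed

text \<open>\<open>T S\<close> is bounded and coercive, so the equation \<open>T S y = T g\<close> is solved by iterating the
  contraction \<open>x \<mapsto> x - \<epsilon> (T S x - T g)\<close>.\<close>

lemma S_surj:
  assumes g: "g \<in> W.H"
  obtains h where "h \<in> U.H" "S h = g"
proof -
  define A where "A h = T (S h)" for h
  have A_in: "A h \<in> U.H" if "h \<in> U.H" for h using that by (simp add: A_def T_in S_in)
  have A_diff: "A (h - k) = A h - A k" if "h \<in> U.H" "k \<in> U.H" for h k
    using that by (simp add: A_def S_diff T_diff S_in)
  obtain c where c: "c > 0" "\<And>h. h \<in> U.H \<Longrightarrow> c * U.nrm h \<le> W.nrm (S h)"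
    using S_bounded_below by blast
  obtain C1 where C1: "C1 > 0" "\<And>f. f \<in> W.H \<Longrightarrow> U.nrm (T f) \<le> C1 * W.nrm f"
    by (rule bounded_T) blast
  obtain C2 where C2: "C2 > 0" "\<And>h. h \<in> U.H \<Longrightarrow> W.nrm (S h) \<le> C2 * U.nrm h"
    by (rule bounded_S) blast
  \<comment> \<open>The summand \<open>c\<^sup>2\<close> forces \<open>c\<^sup>2 \<le> K\<close>,
    which keeps \<open>1 - \<epsilon> * c\<^sup>2\<close> non-negative below.\<close>
  define K where "K = C1 * C2 + c\<^sup>2"
  have K: "K > 0" "c\<^sup>2 \<le> K" using c(1) C1(1) C2(1) by (auto simp: K_def add_pos_pos)
  have A_bound: "U.nrm (A h) \<le> K * U.nrm h" if h: "h \<in> U.H" for h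
  proof -
    have "U.nrm (A h) \<le> C1 * W.nrm (S h)" unfolding A_def by (intro C1 S_in h)
    also have "\<dots> \<le> C1 * (C2 * U.nrm h)" using C1(1) C2(2)[OF h] by (intro mult_left_mono) auto
    also have "\<dots> \<le> K * U.nrm h" using U.norm_nonneg[OF h] by (simp add: K_def algebra_simps)
    finally show ?thesis .
  qed
  have coercive: "c\<^sup>2 * (U.nrm h)\<^sup>2 \<le> Re (U.inner h (A h))" if h: "h \<in> U.H" for h
  proof -
    have "(c * U.nrm h)\<^sup>2 \<le> (W.nrm (S h))\<^sup>2"
      using c U.norm_nonneg[OF h] by (intro power_mono c h) auto
    also have "\<dots> = Re (U.inner h (A h))"
      using arg_cong[OF norm_S_sq[OF h], of Re] U.inner_cnj[OF h A_in[OF h]]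
      by (simp add: A_def[symmetric] del: of_real_power)
    finally show ?thesis by (simp add: power_mult_distrib)
  qed
  \<comment> \<open>This step size minimizes 1 - 2 \<epsilon> c^2 + \<epsilon>^2 K^2, the bound
    found in \<open>contr\<close> for the squared contraction factor; the minimum is 1 - \<epsilon>
    c^2 = q^2.\<close>
  define \<epsilon> where "\<epsilon> = c\<^sup>2 / K\<^sup>2"
  define q where "q = sqrt (1 - \<epsilon> * c\<^sup>2)"
  have \<epsilon>: "\<epsilon> > 0" using c(1) K by (simp add: \<epsilon>_def)
  have \<epsilon>K: "\<epsilon> * K\<^sup>2 = c\<^sup>2" using K by (simp add: \<epsilon>_def)
  have "\<epsilon> * c\<^sup>2 = (c\<^sup>2 / K)\<^sup>2" by (simp add: \<epsilon>_def power_divide power2_eq_square)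
  also have "\<dots> \<le> 1" using K c(1) by (intro power_le_one) auto
  finally have \<epsilon>1: "\<epsilon> * c\<^sup>2 \<le> 1" .
  have q: "0 \<le> q" "q < 1" using \<epsilon> \<epsilon>1 c(1) by (auto simp: q_def)
  let ?c = "\<lambda>r::real. fps_const (complex_of_real r)"
  have contr: "U.nrm (h + ?c (- \<epsilon>) * A h) \<le> q * U.nrm h" if h: "h \<in> U.H" for h
  proof (rule power2_le_imp_le)
    have "(U.nrm (h + ?c (- \<epsilon>) * A h))\<^sup>2
        = (U.nrm h)\<^sup>2 + \<epsilon>\<^sup>2 * (U.nrm (A h))\<^sup>2 - 2 * \<epsilon> * Re (U.inner h (A h))"
      using U.norm_add_sq[OF h U.scale_in_H[OF A_in[OF h]], of "complex_of_real (- \<epsilon>)"]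
        U.norm_scale[OF A_in[OF h], of "complex_of_real (- \<epsilon>)"] \<epsilon>
        U.inner_scale_right[OF A_in[OF h] h, of "complex_of_real (- \<epsilon>)"]
      by (simp add: power_mult_distrib)
    also have "\<dots> \<le> (U.nrm h)\<^sup>2 + \<epsilon>\<^sup>2 * (K * U.nrm h)\<^sup>2 - 2 * \<epsilon> * (c\<^sup>2 * (U.nrm h)\<^sup>2)"
      using \<epsilon> A_bound[OF h] coercive[OF h] U.norm_nonneg[OF A_in[OF h]] U.norm_nonneg[OF h]
      by (intro diff_mono add_mono mult_left_mono power_mono) auto
    also have "\<dots> = (1 + \<epsilon> * (\<epsilon> * K\<^sup>2) - 2 * \<epsilon> * c\<^sup>2) * (U.nrm h)\<^sup>2"
      by (simp add: algebra_simps power2_eq_square)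
    also have "\<dots> = (q * U.nrm h)\<^sup>2"
      unfolding \<epsilon>K using \<epsilon>1 by (simp add: q_def power_mult_distrib)
    finally show "(U.nrm (h + ?c (- \<epsilon>) * A h))\<^sup>2 \<le> (q * U.nrm h)\<^sup>2" .
  qed (use q U.norm_nonneg[OF h] in simp)
  define x where "x = rec_nat 0 (\<lambda>_ x. x - ?c \<epsilon> * (A x - T g))"
  have x_simps: "x 0 = 0" "\<And>n. x (Suc n) = x n - ?c \<epsilon> * (A (x n) - T g)"
    by (simp_all add: x_def)
  have x_in: "x n \<in> U.H" for n
    by (induction n)
      (simp_all add: x_simps U.zero_in_H U.diff_in_H U.scale_in_H A_in T_in g)
  define D where "D = U.nrm (x 1 - x 0)"
  have step: "U.nrm (x (Suc n) - x n) \<le> D * q ^ n" for n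
  proof (induction n)
    case 0 show ?case by (simp add: D_def)
  next
    case (Suc n)
    define d where "d = x (Suc n) - x n"
    have d: "d \<in> U.H" by (simp add: d_def U.diff_in_H x_in)
    have "x (Suc (Suc n)) - x (Suc n)
        = d + ?c (- \<epsilon>) * (A (x (Suc n)) - A (x n))"
      unfolding d_def by (subst x_simps(2)[of "Suc n"], subst (3) x_simps(2)[of n])
        (rule fps_ext, simp add: x_simps algebra_simps)
    then have "x (Suc (Suc n)) - x (Suc n) = d + ?c (- \<epsilon>) * A d"
      by (simp add: d_def A_diff x_in)
    then have "U.nrm (x (Suc (Suc n)) - x (Suc n)) \<le> q * U.nrm d" using contr[OF d] by simp
    also have "\<dots> \<le> q * (D * q ^ n)" using Suc q by (intro mult_left_mono) (auto simp: d_def)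
    finally show ?case by (simp add: mult.left_commute)
  qed
  obtain y where y: "y \<in> U.H" "\<And>n. U.nrm (y - x n) \<le> D * q ^ n / (1 - q)"
    by (rule U.geometric_limit[of x q D]) (use x_in step q in auto)
  have R: "A y - T g \<in> U.H" by (intro U.diff_in_H A_in y T_in g)
  \<comment> \<open>The residual at \<open>x n\<close> is the step \<open>x (Suc n) - x n\<close>
    divided by -\<epsilon>, so it decays geometrically; passing from \<open>x n\<close> to
    \<open>y\<close> costs at most \<open>K\<close> times their distance.\<close>
  have "U.nrm (A y - T g) \<le> (K * D / (1 - q) + D / \<epsilon>) * q ^ n" for n
  proof -
    have "U.nrm (A y - T g) \<le> U.nrm (A y - A (x n)) + U.nrm (A (x n) - T g)"
      by (intro U.norm_diff_triangle A_in y x_in T_in g)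
    also have "\<dots> \<le> K * (D * q ^ n / (1 - q)) + (D * q ^ n) / \<epsilon>"
    proof (rule add_mono)
      have "U.nrm (A y - A (x n)) \<le> K * U.nrm (y - x n)"
        using A_bound[OF U.diff_in_H[OF y(1) x_in]] by (simp add: A_diff y x_in)
      also have "\<dots> \<le> K * (D * q ^ n / (1 - q))" using K y(2) by (intro mult_left_mono) auto
      finally show "U.nrm (A y - A (x n)) \<le> K * (D * q ^ n / (1 - q))" .
      have "x (Suc n) - x n = ?c (- \<epsilon>) * (A (x n) - T g)"
        by (rule fps_ext) (simp add: x_simps)
      then have "\<epsilon> * U.nrm (A (x n) - T g) \<le> D * q ^ n"
        using step[of n] \<epsilon>
          U.norm_scale[OF U.diff_in_H[OF A_in[OF x_in] T_in[OF g]], of "complex_of_real (- \<epsilon>)"]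
        by simp
      then show "U.nrm (A (x n) - T g) \<le> (D * q ^ n) / \<epsilon>"
        using \<epsilon> by (simp add: pos_le_divide_eq mult.commute)
    qed
    finally show ?thesis by (simp add: algebra_simps)
  qed
  moreover have "(\<lambda>n. (K * D / (1 - q) + D / \<epsilon>) * q ^ n) \<longlonglongrightarrow> (K * D / (1 - q) + D / \<epsilon>) * 0"
    using q by (intro tendsto_intros LIMSEQ_power_zero) auto
  ultimately have "U.nrm (A y - T g) \<le> 0"
    by (auto intro: LIMSEQ_le_const)
  then have "A y = T g" using U.norm_eq_0D[OF R] U.norm_nonneg[OF R] by simp
  then have "S y = g"
    using bij S_in[OF y(1)] g by (auto simp: A_def bij_betw_def inj_on_def)
  then show ?thesis using that y(1) by blast
qed

end

section \<open>Weighted composition operators\<close>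

text \<open>Boundedness by \<open>C\<close> of the weighted composition operator with multiplier
  \<open>m\<close> and symbol \<open>\<phi>\<close>, acting from the space of \<open>u\<close> to
  that of \<open>w\<close>. It is phrased through values on the disk because \<open>m\<close> and
  \<open>\<phi>\<close> are a priori arbitrary functions without power series.\<close>

definition wcomp ::
    "(nat \<Rightarrow> real) \<Rightarrow> (nat \<Rightarrow> real) \<Rightarrow> (complex \<Rightarrow> complex) \<Rightarrow> (complex \<Rightarrow> complex) \<Rightarrow> real \<Rightarrow> bool" where
  "wcomp w u m \<phi> C \<longleftrightarrow>
     (\<forall>h\<in>weighted_hardy u. \<exists>g\<in>weighted_hardy w.
        (\<forall>z\<in>unit_disk. eval_fps g z = m z * eval_fps h (\<phi> z)) \<and> wh_norm w g \<le> C * wh_norm u h)"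

lemma wcomp_compose:
  assumes "wcomp w u m \<phi> C" "wcomp u v n \<psi> D" "\<phi> \<in> unit_disk \<rightarrow> unit_disk" "0 \<le> C"
  shows "wcomp w v (\<lambda>z. m z * n (\<phi> z)) (\<lambda>z. \<psi> (\<phi> z)) (C * D)"
  unfolding wcomp_def
proof
  fix h assume "h \<in> weighted_hardy v"
  then obtain k where k: "k \<in> weighted_hardy u" "wh_norm u k \<le> D * wh_norm v h"
    "\<And>z. z \<in> unit_disk \<Longrightarrow> eval_fps k z = n z * eval_fps h (\<psi> z)"
    using assms(2) unfolding wcomp_def by blast
  then obtain g where g: "g \<in> weighted_hardy w" "wh_norm w g \<le> C * wh_norm u k"
    "\<And>z. z \<in> unit_disk \<Longrightarrow> eval_fps g z = m z * eval_fps k (\<phi> z)"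
    using assms(1) unfolding wcomp_def by blast
  have "wh_norm w g \<le> C * D * wh_norm v h"
    using g(2) mult_left_mono[OF k(2) assms(4)] by simp
  moreover have "eval_fps g z = m z * n (\<phi> z) * eval_fps h (\<psi> (\<phi> z))" if "z \<in> unit_disk" for z
    using g(3)[OF that] k(3)[OF funcset_mem[OF assms(3) that]] by (simp add: mult.assoc)
  ultimately show "\<exists>g\<in>weighted_hardy w.
      (\<forall>z\<in>unit_disk. eval_fps g z = m z * n (\<phi> z) * eval_fps h (\<psi> (\<phi> z)))
      \<and> wh_norm w g \<le> C * D * wh_norm v h"
    using g(1) by blast
qed

lemma wcomp_cong:
  assumes "wcomp w u m \<phi> C" "\<And>z. z \<in> unit_disk \<Longrightarrow> m z = n z"
    "\<And>z. z \<in> unit_disk \<Longrightarrow> \<phi> z = \<psi> z"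
  shows "wcomp w u n \<psi> C"
  using assms by (simp add: wcomp_def)

text \<open>A rotation multiplies the \<open>n\<close>-th coefficient by \<eta>^n, and the weighted
  norm sees only the moduli of coefficients.\<close>

lemma wcomp_rotation:
  assumes "cmod \<eta> = 1"
  shows "wcomp w w (\<lambda>_. 1) (\<lambda>z. \<eta> * z) 1"
  unfolding wcomp_def
proof
  fix h assume h: "h \<in> weighted_hardy w"
  define g where "g = Abs_fps (\<lambda>n. \<eta> ^ n * fps_nth h n)"
  have n: "cmod (fps_nth g n) = cmod (fps_nth h n)" for n
    using assms by (simp add: g_def norm_mult norm_power)
  have "g \<in> weighted_hardy w" using h by (simp add: weighted_hardy_def n)
  moreover have "wh_norm w g = wh_norm w h"
    unfolding wh_norm_def wh_inner_def by (simp add: complex_norm_square[symmetric] n)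
  moreover have "eval_fps g z = eval_fps h (\<eta> * z)" for z
    by (simp add: eval_fps_def g_def power_mult_distrib mult_ac)
  ultimately show "\<exists>g\<in>weighted_hardy w.
      (\<forall>z\<in>unit_disk. eval_fps g z = 1 * eval_fps h (\<eta> * z)) \<and> wh_norm w g \<le> 1 * wh_norm w h"
    by (intro bexI[of _ g]) auto
qed

section \<open>Members of the spaces as holomorphic functions on the disk\<close>

lemma hfs_conv_radius:
  assumes "hilbert_function_space_on_disk w" "f \<in> weighted_hardy w"
  shows "1 \<le> fps_conv_radius f"
  unfolding fps_conv_radius_def
proof (rule conv_radius_geI_ex')
  fix r :: real assume "0 < r" "ereal r < 1"
  then have "complex_of_real r \<in> unit_disk" by simp
  then show "summable (\<lambda>n. fps_nth f n * complex_of_real r ^ n)"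
    using assms unfolding hilbert_function_space_on_disk_def by blast
qed

lemma hfs_holomorphic:
  assumes "hilbert_function_space_on_disk w" "f \<in> weighted_hardy w"
  shows "eval_fps f holomorphic_on unit_disk"
proof (rule holomorphic_on_eval_fps)
  show "unit_disk \<subseteq> eball 0 (fps_conv_radius f)"
  proof
    fix z :: complex assume "z \<in> unit_disk"
    then have "ereal (cmod z) < 1" by simp
    also note hfs_conv_radius[OF assms]
    finally show "z \<in> eball 0 (fps_conv_radius f)" by (simp add: in_eball_iff)
  qed
qed

lemma hfs_eval_inject:
  assumes "hilbert_function_space_on_disk w" "f \<in> weighted_hardy w" "g \<in> weighted_hardy w"
    and "\<And>z. z \<in> unit_disk \<Longrightarrow> eval_fps f z = eval_fps g z"
  shows "f = g"
proof (rule eval_fps_eqD)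
  show "0 < fps_conv_radius f" "0 < fps_conv_radius g"
    using hfs_conv_radius[OF assms(1)] assms(2,3) by (auto intro: less_le_trans[of 0 1])
  have "eventually (\<lambda>z::complex. z \<in> unit_disk) (nhds 0)"
    by (rule eventually_nhds_in_open) auto
  then show "eventually (\<lambda>z. eval_fps f z = eval_fps g z) (nhds 0)"
    by eventually_elim (rule assms(4))
qed

text \<open>The images of \<open>1\<close> and \<open>fps_X\<close> represent m and m \<phi>; as m
  has no zeros, their quotient recovers \<phi>.\<close>

lemma wcomp_holomorphic:
  assumes u: "\<And>n. u n > 0" and w: "hilbert_function_space_on_disk w"
    and W: "wcomp w u m \<phi> C" and m: "\<And>z. z \<in> unit_disk \<Longrightarrow> m z \<noteq> 0"
  shows "\<phi> holomorphic_on unit_disk"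
proof -
  interpret U: weighted_hardy_space u by standard (rule u)
  have "fps_const 1 * fps_X ^ 0 \<in> U.H" "fps_const 1 * fps_X ^ 1 \<in> U.H"
    by (rule U.monom_in_H)+
  then have "1 \<in> U.H" "fps_X \<in> U.H" by simp_all
  then obtain f g where f: "f \<in> weighted_hardy w" "\<And>z. z \<in> unit_disk \<Longrightarrow> eval_fps f z = m z"
    and g: "g \<in> weighted_hardy w" "\<And>z. z \<in> unit_disk \<Longrightarrow> eval_fps g z = m z * \<phi> z"
    using W unfolding wcomp_def by (metis eval_fps_1 eval_fps_X mult.right_neutral)
  have "(\<lambda>z. eval_fps g z / eval_fps f z) holomorphic_on unit_disk"
    by (intro holomorphic_on_divide hfs_holomorphic[OF w] f g) (simp add: f(2) m)
  then show ?thesis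
    by (rule holomorphic_transform) (use f(2) g(2) m in simp)
qed

text \<open>The image of z^k is a \<eta>^k z^k, again a multiple of one monomial, so the operator
  bound compares the single weights \<open>w k\<close> and \<open>u k\<close>.\<close>

lemma wcomp_const_rotation_bound:
  assumes u: "\<And>n. u n > 0" and w: "\<And>n. w n > 0" "hilbert_function_space_on_disk w"
    and W: "wcomp w u (\<lambda>_. a) (\<lambda>z. \<eta> * z) C" and \<eta>: "cmod \<eta> = 1"
  shows "cmod a * sqrt (w k) \<le> C * sqrt (u k)"
proof -
  interpret U: weighted_hardy_space u by standard (rule u)
  interpret W: weighted_hardy_space w by standard (rule w)
  obtain g where g: "g \<in> W.H" "W.nrm g \<le> C * sqrt (u k)"
    "\<And>z. z \<in> unit_disk \<Longrightarrow> eval_fps g z = a * (\<eta> * z) ^ k"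
    using W U.monom_in_H[of 1 k] U.norm_monom[of 1 k] unfolding wcomp_def by fastforce
  have "g = fps_const (a * \<eta> ^ k) * fps_X ^ k"
  proof (rule hfs_eval_inject[OF w(2) g(1) W.monom_in_H])
    fix z :: complex assume "z \<in> unit_disk"
    then show "eval_fps g z = eval_fps (fps_const (a * \<eta> ^ k) * fps_X ^ k) z"
      by (simp add: g(3) eval_fps_mult power_mult_distrib)
  qed
  then have "W.nrm g = cmod a * sqrt (w k)"
    using W.norm_monom[of "a * \<eta> ^ k" k] \<eta> by (simp add: norm_mult norm_power)
  then show ?thesis using g(2) by simp
qed

text \<open>The bounds on the images of \<open>1\<close> give \<open>\<parallel>m\<parallel>\<^sup>2 \<le> u\<^sub>0 \<le> \<bar>m 0\<bar>\<^sup>2 w\<^sub>0\<close>, so that \<open>m\<close> has no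
  higher Taylor coefficients.\<close>

lemma wcomp_contractive_rotation_const:
  assumes u: "\<And>n. u n > 0" and w: "\<And>n. w n > 0"
    and W: "wcomp w u m (\<lambda>z. \<eta> * z) 1" and U: "wcomp u w n (\<lambda>z. \<theta> * z) 1"
    and mn: "m 0 * n 0 = 1" and z: "z \<in> unit_disk"
  shows "m z = m 0"
proof -
  interpret U: weighted_hardy_space u by standard (rule u)
  interpret W: weighted_hardy_space w by standard (rule w)
  have one: "1 \<in> U.H" "1 \<in> W.H" "U.nrm 1 = sqrt (u 0)" "W.nrm 1 = sqrt (w 0)"
    using U.monom_in_H[of 1 0] W.monom_in_H[of 1 0] U.norm_monom[of 1 0] W.norm_monom[of 1 0]
    by simp_all
  obtain f where f: "f \<in> W.H" "W.nrm f \<le> sqrt (u 0)" "\<And>z. z \<in> unit_disk \<Longrightarrow> eval_fps f z = m z"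
    using W one(1,3) unfolding wcomp_def by fastforce
  obtain g where g: "g \<in> U.H" "U.nrm g \<le> sqrt (w 0)" "\<And>z. z \<in> unit_disk \<Longrightarrow> eval_fps g z = n z"
    using U one(2,4) unfolding wcomp_def by fastforce
  have f0: "fps_nth f 0 = m 0" and g0: "fps_nth g 0 = n 0"
    using f(3)[of 0] g(3)[of 0] by (simp_all add: eval_fps_at_0)
  have "cmod (n 0) * sqrt (u 0) \<le> sqrt (w 0)"
    using U.coeff_le[OF g(1), of 0] g(2) g0 by simp
  then have "cmod (m 0) * (cmod (n 0) * sqrt (u 0)) \<le> cmod (m 0) * sqrt (w 0)"
    by (rule mult_left_mono) simp
  moreover have "cmod (m 0) * cmod (n 0) = 1" using mn by (simp flip: norm_mult)
  ultimately have "sqrt (u 0) \<le> cmod (m 0) * sqrt (w 0)"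
    by (simp flip: mult.assoc)
  then have "(W.nrm f)\<^sup>2 \<le> (cmod (m 0) * sqrt (w 0))\<^sup>2"
    using f(2) by (intro power_mono W.norm_nonneg f) auto
  then have le: "(W.nrm f)\<^sup>2 \<le> (cmod (m 0))\<^sup>2 * w 0"
    using w[of 0] by (simp add: power_mult_distrib)
  \<comment> \<open>The constant term alone exhausts the upper bound for the norm of
    \<open>f\<close>, leaving no room for another coefficient.\<close>
  have "fps_nth f k = 0" if "k \<noteq> 0" for k
  proof -
    have "(cmod (m 0))\<^sup>2 * w 0 + (cmod (fps_nth f k))\<^sup>2 * w k \<le> (W.nrm f)\<^sup>2"
      using W.partial_sum_le[OF f(1), of "{0, k}"] that by (simp add: f0)
    then have "(cmod (fps_nth f k))\<^sup>2 * w k \<le> 0" using le by linarith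
    then show ?thesis using w[of k] by (simp add: mult_le_0_iff)
  qed
  then have "f = fps_const (m 0)" by (intro fps_ext) (simp add: f0)
  then show ?thesis using f(3)[OF z] by simp
qed

section \<open>Automorphisms of the disk\<close>

text \<open>The Schwarz lemma for \<open>f\<close> and for its left inverse \<open>g\<close> gives
  opposite inequalities, hence equality at the point 1/2; the equality case makes \<open>f\<close> a
  rotation.\<close>

lemma disk_automorphism_fixing_0:
  assumes "f holomorphic_on unit_disk" "g holomorphic_on unit_disk"
    and "f \<in> unit_disk \<rightarrow> unit_disk" "g \<in> unit_disk \<rightarrow> unit_disk"
    and gf: "\<And>z. z \<in> unit_disk \<Longrightarrow> g (f z) = z" and f0: "f 0 = 0"
  obtains \<eta> where "cmod \<eta> = 1" "\<And>z. z \<in> unit_disk \<Longrightarrow> f z = \<eta> * z"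
proof -
  have g0: "g 0 = 0" using gf[of 0] f0 by simp
  have lt: "cmod (f z) < 1" "cmod (g z) < 1" if "cmod z < 1" for z
    using that assms(3,4) by (auto simp: Pi_iff)
  let ?z = "1/2 :: complex"
  have "cmod (f ?z) \<le> cmod ?z"
    by (rule Schwarz_Lemma(1)) (use assms(1) f0 lt in auto)
  moreover have "cmod (g (f ?z)) \<le> cmod (f ?z)"
    by (rule Schwarz_Lemma(1)) (use assms(2) g0 lt in auto)
  ultimately have "cmod (f ?z) = cmod ?z" using gf[of ?z] by simp
  then have "\<exists>z. cmod z < 1 \<and> z \<noteq> 0 \<and> cmod (f z) = cmod z" by (intro exI[of _ ?z]) simp
  then have "\<exists>\<alpha>. (\<forall>z. norm z < 1 \<longrightarrow> f z = \<alpha> * z) \<and> norm \<alpha> = 1"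
    using Schwarz_Lemma(3)[OF assms(1) f0 lt(1), of 0] by auto
  then show ?thesis using that by auto
qed

lemma unimodular_factor:
  assumes "cmod z = cmod z'"
  obtains \<eta> where "cmod \<eta> = 1" "\<eta> * z = z'"
proof (cases "z = 0")
  case True
  then show ?thesis using assms that[of 1] by simp
next
  case False
  then have "cmod (z' / z) = 1" "z' / z * z = z'" using assms by (auto simp: norm_divide)
  then show ?thesis by (rule that)
qed

text \<open>On the circle of radius \<open>\<bar>f 0\<bar>\<close> the function \<open>\<bar>g\<bar>\<close> vanishes at \<open>f 0\<close> and somewhere is at
  least \<open>\<bar>g 0\<bar>\<close> by the maximum principle, hence it takes the value \<open>\<bar>g 0\<bar>\<close>.\<close>

lemma disk_automorphism_returning_to_0:
  assumes hol: "g holomorphic_on unit_disk"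
    and f: "f \<in> unit_disk \<rightarrow> unit_disk" and g: "g \<in> unit_disk \<rightarrow> unit_disk"
    and gf: "\<And>z. z \<in> unit_disk \<Longrightarrow> g (f z) = z" and fg: "\<And>z. z \<in> unit_disk \<Longrightarrow> f (g z) = z"
  obtains \<eta> \<theta> where "cmod \<eta> = 1" "cmod \<theta> = 1" "f (\<theta> * g (\<eta> * f 0)) = 0"
proof -
  define a where "a = f 0"
  have a: "cmod a < 1" using f by (auto simp: a_def Pi_iff)
  have ga: "g a = 0" using gf[of 0] by (simp add: a_def)
  have sub: "cball 0 (cmod a) \<subseteq> unit_disk" using a by auto
  have cont: "continuous_on unit_disk g" using hol by (rule holomorphic_on_imp_continuous_on)
  have "\<exists>p. cmod p = cmod a \<and> cmod (g 0) \<le> cmod (g p)"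
  proof -
    have "continuous_on (sphere 0 (cmod a)) (\<lambda>z. cmod (g z))"
      using sub by (intro continuous_on_norm continuous_on_subset[OF cont]) auto
    then obtain M where M: "M \<in> sphere 0 (cmod a)"
      "\<And>z. z \<in> sphere 0 (cmod a) \<Longrightarrow> cmod (g z) \<le> cmod (g M)"
      using continuous_attains_sup[of "sphere 0 (cmod a)" "\<lambda>z. cmod (g z)"] by auto
    \<comment> \<open>The degenerate case \<open>a = 0\<close> is covered: disk and circle then both
      shrink to the point 0.\<close>
    have "cmod (g 0) \<le> cmod (g M)"
    proof (rule maximum_modulus_frontier[of g "cball 0 (cmod a)"])
      show "g holomorphic_on interior (cball 0 (cmod a))"
        using sub by (intro holomorphic_on_subset[OF hol]) (auto simp: interior_cball)
      show "continuous_on (closure (cball 0 (cmod a))) g"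
        using sub by (intro continuous_on_subset[OF cont]) auto
      show "cmod (g z) \<le> cmod (g M)" if "z \<in> frontier (cball 0 (cmod a))" for z
        using that M(2) by (simp add: frontier_cball)
    qed auto
    then show ?thesis using M(1) by auto
  qed
  then obtain p where p: "cmod p = cmod a" "cmod (g 0) \<le> cmod (g p)" by blast
  have "connected (sphere (0::complex) (cmod a))" by (rule connected_sphere) simp
  moreover have "continuous_on (sphere 0 (cmod a)) (\<lambda>z. cmod (g z))"
    using sub by (intro continuous_on_norm continuous_on_subset[OF cont]) auto
  ultimately have "connected ((\<lambda>z. cmod (g z)) ` sphere 0 (cmod a))"
    by (rule connected_continuous_image[rotated])
  moreover have "0 \<in> (\<lambda>z. cmod (g z)) ` sphere 0 (cmod a)"
    using ga by (intro image_eqI[of _ _ a]) auto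
  moreover have "cmod (g p) \<in> (\<lambda>z. cmod (g z)) ` sphere 0 (cmod a)" using p(1) by auto
  ultimately have "cmod (g 0) \<in> (\<lambda>z. cmod (g z)) ` sphere 0 (cmod a)"
    using connectedD_interval p(2) norm_ge_zero by blast
  then obtain q where "q \<in> sphere 0 (cmod a)" "cmod (g 0) = cmod (g q)" by (rule imageE)
  then have q: "cmod a = cmod q" "cmod (g q) = cmod (g 0)" by simp_all
  \<comment> \<open>The first rotation moves \<open>a\<close> to \<open>q\<close>, the second moves
    \<open>g q\<close> to \<open>g 0\<close>, and \<open>f\<close> sends \<open>g 0\<close> to
    0.\<close>
  obtain \<eta> where \<eta>: "cmod \<eta> = 1" "\<eta> * a = q" using unimodular_factor[OF q(1)] by blast
  obtain \<theta> where \<theta>: "cmod \<theta> = 1" "\<theta> * g q = g 0" using unimodular_factor[OF q(2)] by blast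
  have "f (\<theta> * g (\<eta> * f 0)) = 0" using \<eta>(2) \<theta>(2) fg[of 0] by (simp add: a_def)
  then show ?thesis using that \<eta>(1) \<theta>(1) by blast
qed

text \<open>The rotations act isometrically on both spaces, so \<open>\<phi>\<close> may be replaced by
  \<open>\<tau> = \<phi> \<circ> \<theta> \<circ> \<phi>\<^sup>-\<^sup>1 \<circ> \<eta> \<circ> \<phi>\<close>, which is a rotation when \<open>\<eta>\<close> and \<open>\<theta>\<close> are chosen such that
  \<open>\<tau> 0 = 0\<close>.\<close>

lemma wcomp_reduce_to_rotation:
  assumes u: "\<And>n. u n > 0" "hilbert_function_space_on_disk u"
    and w: "\<And>n. w n > 0" "hilbert_function_space_on_disk w"
    and W: "wcomp w u m \<phi> C" "0 \<le> C" and U: "wcomp u w n \<psi> D" "0 \<le> D"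
    and \<phi>: "\<phi> \<in> unit_disk \<rightarrow> unit_disk" and \<psi>: "\<psi> \<in> unit_disk \<rightarrow> unit_disk"
    and \<psi>\<phi>: "\<And>z. z \<in> unit_disk \<Longrightarrow> \<psi> (\<phi> z) = z" and \<phi>\<psi>: "\<And>z. z \<in> unit_disk \<Longrightarrow> \<phi> (\<psi> z) = z"
    and mn: "\<And>z. z \<in> unit_disk \<Longrightarrow> m z * n (\<phi> z) = 1"
  obtains \<zeta> m' n' where "cmod \<zeta> = 1"
    "wcomp w u m' (\<lambda>z. \<zeta> * z) (C * D * C)" "wcomp u w n' (\<lambda>z. cnj \<zeta> * z) (D * C * D)"
    "\<And>z. z \<in> unit_disk \<Longrightarrow> m' z * n' (\<zeta> * z) = 1"
    "\<And>z. z \<in> unit_disk \<Longrightarrow> \<exists>x\<in>unit_disk. \<exists>y\<in>unit_disk. m' z = m z * n y * m x"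
proof -
  have nm: "n z * m (\<psi> z) = 1" if "z \<in> unit_disk" for z
    using mn[OF funcset_mem[OF \<psi> that]] \<phi>\<psi>[OF that] by (simp add: mult.commute)
  have hol: "\<phi> holomorphic_on unit_disk" "\<psi> holomorphic_on unit_disk"
    using wcomp_holomorphic[OF u(1) w(2) W(1)] wcomp_holomorphic[OF w(1) u(2) U(1)] mn nm
    by (metis mult_zero_left zero_neq_one)+
  obtain \<eta> \<theta> where \<eta>: "cmod \<eta> = 1" and \<theta>: "cmod \<theta> = 1" and 0: "\<phi> (\<theta> * \<psi> (\<eta> * \<phi> 0)) = 0"
    using disk_automorphism_returning_to_0[OF hol(2) \<phi> \<psi> \<psi>\<phi> \<phi>\<psi>] by blast
  have rot: "(\<lambda>z. \<xi> * z) \<in> unit_disk \<rightarrow> unit_disk" if "cmod \<xi> = 1" for \<xi>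
    using that by (auto simp: norm_mult)
  have inv: "cnj \<xi> * (\<xi> * z) = z" "\<xi> * (cnj \<xi> * z) = z" if "cmod \<xi> = 1" for \<xi> z
  proof -
    have 1: "\<xi> * cnj \<xi> = 1" "cnj \<xi> * \<xi> = 1"
      using complex_norm_square[of \<xi>] that by (simp_all add: mult.commute)
    show "cnj \<xi> * (\<xi> * z) = z" "\<xi> * (cnj \<xi> * z) = z"
      by (simp_all only: mult.assoc[symmetric] 1 mult_1)
  qed
  have cnj_rot: "cmod (cnj \<eta>) = 1" "cmod (cnj \<theta>) = 1" using \<eta> \<theta> by simp_all
  note disk = funcset_mem[OF \<phi>] funcset_mem[OF \<psi>] funcset_mem[OF rot[OF \<eta>]] funcset_mem[OF rot[OF \<theta>]]
    funcset_mem[OF rot[OF cnj_rot(1)]] funcset_mem[OF rot[OF cnj_rot(2)]]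
  define \<tau> where "\<tau> z = \<phi> (\<theta> * \<psi> (\<eta> * \<phi> z))" for z
  \<comment> \<open>The factors of \<open>\<tau>\<close> are undone in reverse order; this supplies
    the holomorphic inverse for the Schwarz argument.\<close>
  define \<kappa> where "\<kappa> z = \<psi> (cnj \<eta> * \<phi> (cnj \<theta> * \<psi> z))" for z
  have \<tau>: "\<tau> \<in> unit_disk \<rightarrow> unit_disk" and \<kappa>: "\<kappa> \<in> unit_disk \<rightarrow> unit_disk"
    unfolding \<tau>_def \<kappa>_def by (intro Pi_I disk; assumption)+
  have \<kappa>\<tau>: "\<kappa> (\<tau> z) = z" if "z \<in> unit_disk" for z
    unfolding \<tau>_def \<kappa>_def using that by (simp only: disk \<psi>\<phi> \<phi>\<psi> inv \<eta> \<theta>)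
  have comp: "(\<lambda>z. p (q z)) holomorphic_on unit_disk"
    if "p holomorphic_on unit_disk" "q holomorphic_on unit_disk" "q \<in> unit_disk \<rightarrow> unit_disk" for p q
    using holomorphic_on_compose_gen[OF that(2,1)] that(3) by (auto simp: o_def)
  have hol\<tau>: "\<tau> holomorphic_on unit_disk"
    unfolding \<tau>_def[abs_def]
    by (intro comp[OF hol(1)] comp[OF hol(2)] holomorphic_on_mult holomorphic_on_const hol Pi_I disk; assumption)
  have hol\<kappa>: "\<kappa> holomorphic_on unit_disk"
    unfolding \<kappa>_def[abs_def]
    by (intro comp[OF hol(1)] comp[OF hol(2)] holomorphic_on_mult holomorphic_on_const hol Pi_I disk; assumption)
  obtain \<zeta> where \<zeta>: "cmod \<zeta> = 1" "\<And>z. z \<in> unit_disk \<Longrightarrow> \<tau> z = \<zeta> * z"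
    using disk_automorphism_fixing_0[OF hol\<tau> hol\<kappa> \<tau> \<kappa> \<kappa>\<tau>] 0 by (auto simp: \<tau>_def)
  have \<kappa>\<zeta>: "\<kappa> z = cnj \<zeta> * z" if "z \<in> unit_disk" for z
    using \<kappa>\<tau>[of "cnj \<zeta> * z"] \<zeta>(2)[of "cnj \<zeta> * z"] that \<zeta>(1) inv(2)[OF \<zeta>(1)] by (simp add: norm_mult)
  \<comment> \<open>The chain is operator, rotation, reverse operator, rotation, operator. General
    weights allow its use for \<open>\<tau>\<close> and, with the roles exchanged, for
    \<open>\<kappa>\<close>.\<close>
  have comp5: "wcomp w1 w2 (\<lambda>z. p z * q (\<alpha> * f z) * p (\<beta> * g (\<alpha> * f z))) (\<lambda>z. f (\<beta> * g (\<alpha> * f z))) (A * B * A)"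
    if pq: "wcomp w1 w2 p f A" "wcomp w2 w1 q g B" "0 \<le> A" "0 \<le> B" "cmod \<alpha> = 1" "cmod \<beta> = 1"
      and fg: "f \<in> unit_disk \<rightarrow> unit_disk" "g \<in> unit_disk \<rightarrow> unit_disk" for w1 w2 p q f g A B \<alpha> \<beta>
  proof -
    note R = funcset_mem[OF rot[OF pq(5)]] funcset_mem[OF rot[OF pq(6)]]
      funcset_mem[OF fg(1)] funcset_mem[OF fg(2)]
    have "wcomp w1 w2 (\<lambda>z. p z * 1) (\<lambda>z. \<alpha> * f z) (A * 1)"
      by (rule wcomp_compose[OF pq(1) wcomp_rotation fg(1) pq(3)]) fact
    then have "wcomp w1 w1 (\<lambda>z. p z * 1 * q (\<alpha> * f z)) (\<lambda>z. g (\<alpha> * f z)) (A * 1 * B)"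
      by (rule wcomp_compose[OF _ pq(2)]) (use pq(3) in \<open>auto intro!: R\<close>)
    then have "wcomp w1 w1 (\<lambda>z. p z * 1 * q (\<alpha> * f z) * 1) (\<lambda>z. \<beta> * g (\<alpha> * f z)) (A * 1 * B * 1)"
      by (rule wcomp_compose[OF _ wcomp_rotation]) (use pq(3,4,6) in \<open>auto intro!: R\<close>)
    then have "wcomp w1 w2 (\<lambda>z. p z * 1 * q (\<alpha> * f z) * 1 * p (\<beta> * g (\<alpha> * f z)))
        (\<lambda>z. f (\<beta> * g (\<alpha> * f z))) (A * 1 * B * 1 * A)"
      by (rule wcomp_compose[OF _ pq(1)]) (use pq(3,4) in \<open>auto intro!: R\<close>)
    then show ?thesis by simp
  qed
  define m' where "m' z = m z * n (\<eta> * \<phi> z) * m (\<theta> * \<psi> (\<eta> * \<phi> z))" for z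
  define n' where "n' z = n z * m (cnj \<theta> * \<psi> z) * n (cnj \<eta> * \<phi> (cnj \<theta> * \<psi> z))" for z
  have W': "wcomp w u m' (\<lambda>z. \<zeta> * z) (C * D * C)"
    by (rule wcomp_cong[OF comp5[OF W(1) U(1) W(2) U(2) \<eta> \<theta> \<phi> \<psi>]])
      (simp_all add: m'_def \<zeta>(2)[unfolded \<tau>_def])
  have U': "wcomp u w n' (\<lambda>z. cnj \<zeta> * z) (D * C * D)"
    by (rule wcomp_cong[OF comp5[OF U(1) W(1) U(2) W(2) cnj_rot(2,1) \<psi> \<phi>]])
      (simp_all add: n'_def \<kappa>\<zeta>[unfolded \<kappa>_def])
  have "m' z * n' (\<zeta> * z) = 1" if z: "z \<in> unit_disk" for z
  proof -
    \<comment> \<open>\<open>y1\<close> and \<open>y2\<close> are intermediate points on the way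
      from \<open>z\<close> to \<open>\<tau> z\<close>. At \<open>z\<close>, \<open>y1\<close> and
      \<open>y2\<close> the factors of the two composite multipliers cancel in pairs.\<close>
    define y1 where "y1 = \<eta> * \<phi> z"
    define y2 where "y2 = \<theta> * \<psi> y1"
    have y: "y1 \<in> unit_disk" "y2 \<in> unit_disk" unfolding y1_def y2_def by (intro disk z)+
    have "n' (\<zeta> * z) = n' (\<phi> y2)" using \<zeta>(2)[OF z] by (simp add: \<tau>_def y1_def y2_def)
    also have "\<dots> = n (\<phi> y2) * m (\<psi> y1) * n (\<phi> z)"
      unfolding n'_def using z y
      by (simp add: \<psi>\<phi>) (simp add: y2_def inv \<theta> \<phi>\<psi>, simp add: y1_def inv \<eta>)
    finally have "m' z * n' (\<zeta> * z)
        = (m z * n (\<phi> z)) * (n y1 * m (\<psi> y1)) * (m y2 * n (\<phi> y2))"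
      by (simp add: m'_def y1_def y2_def)
    then show ?thesis by (simp only: mn[OF z] nm[OF y(1)] mn[OF y(2)] mult_1)
  qed
  \<comment> \<open>This product form lets constancy of the original multipliers pass to
    \<open>m'\<close>.\<close>
  moreover have "\<exists>x\<in>unit_disk. \<exists>y\<in>unit_disk. m' z = m z * n y * m x" if "z \<in> unit_disk" for z
    unfolding m'_def
    by (rule bexI[of _ "\<theta> * \<psi> (\<eta> * \<phi> z)"], rule bexI[of _ "\<eta> * \<phi> z"], rule refl)
      (intro disk that)+
  ultimately show ?thesis using that[OF \<zeta>(1) W' U'] by blast
qed

section \<open>Diagonal operators\<close>

text \<open>The weighted squares are compared term by term. The bound serves the diagonal
  isomorphism, its inverse, and the inclusion of one space in the other.\<close>

lemma diagonal_operator_bound: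
  assumes w: "\<And>n. w n > 0" and u: "\<And>n. u n > 0"
    and d: "\<And>n. (d n)\<^sup>2 * u n \<le> K * w n" and f: "f \<in> weighted_hardy w"
  shows "Abs_fps (\<lambda>n. complex_of_real (d n) * fps_nth f n) \<in> weighted_hardy u"
    and "wh_norm u (Abs_fps (\<lambda>n. complex_of_real (d n) * fps_nth f n)) \<le> sqrt K * wh_norm w f"
proof -
  interpret U: weighted_hardy_space u by standard (rule u)
  interpret W: weighted_hardy_space w by standard (rule w)
  let ?g = "Abs_fps (\<lambda>n. complex_of_real (d n) * fps_nth f n)"
  have "0 \<le> (d 0)\<^sup>2 * u 0" using U.nonneg by simp
  then have "0 \<le> K * w 0" using d[of 0] by linarith
  then have K: "0 \<le> K" using w[of 0] by (simp add: zero_le_mult_iff)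
  have B: "0 \<le> sqrt K * W.nrm f" using K W.norm_nonneg[OF f] by simp
  have "(\<Sum>n<N. (cmod (fps_nth ?g n))\<^sup>2 * u n) \<le> (sqrt K * W.nrm f)\<^sup>2" for N
  proof -
    have "(\<Sum>n<N. (cmod (fps_nth ?g n))\<^sup>2 * u n) = (\<Sum>n<N. (cmod (fps_nth f n))\<^sup>2 * ((d n)\<^sup>2 * u n))"
      by (simp add: norm_mult power_mult_distrib mult_ac)
    also have "\<dots> \<le> (\<Sum>n<N. (cmod (fps_nth f n))\<^sup>2 * (K * w n))"
      by (intro sum_mono mult_left_mono d) auto
    also have "\<dots> = K * (\<Sum>n<N. (cmod (fps_nth f n))\<^sup>2 * w n)"
      by (simp add: sum_distrib_left mult_ac)
    also have "\<dots> \<le> K * (W.nrm f)\<^sup>2"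
      by (intro mult_left_mono W.partial_sum_le f K) simp
    finally show ?thesis using K by (simp add: power_mult_distrib)
  qed
  from U.norm_leI[OF B this] show "?g \<in> U.H" "U.nrm ?g \<le> sqrt K * W.nrm f" by auto
qed

text \<open>The factor w_n / u_n turns the kernel coefficient 1 / w_n into 1 / u_n, so kernels go to
  multiples of kernels at the same point. It also gives <T f, h>_u = \<mu> <f, h>_w, so the adjoint
  is \<mu> times the inclusion. The scalar \<mu> is kept free to normalize \<open>T\<close> to an
  isometry later.\<close>

lemma diagonal_hfs_isomorphism:
  fixes \<mu> :: real
  assumes w: "\<And>n. w n > 0" and u: "\<And>n. u n > 0" and hfs: "hilbert_function_space_on_disk u"
    and eq: "weights_equiv w u" and \<mu>: "\<mu> > 0"
  defines "T \<equiv> \<lambda>f. Abs_fps (\<lambda>n. complex_of_real (\<mu> * (w n / u n)) * fps_nth f n)"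
  shows "hfs_isomorphism w u T" "adjoint_is_composition w u T (complex_of_real \<mu>) (\<lambda>z. z)"
proof -
  interpret W: weighted_hardy_space w by standard (rule w)
  obtain \<epsilon> M where \<epsilon>: "\<epsilon> > 0" "\<And>n. \<epsilon> < w n / u n" and M: "M > 0" "\<And>n. w n / u n < M"
    using eq unfolding weights_equiv_def by blast
  have wu: "\<epsilon> * u n \<le> w n" "w n \<le> M * u n" for n
    using \<epsilon>(2)[of n] M(2)[of n] u[of n] by (simp_all add: field_simps)
  have "(\<mu> * (w n / u n))\<^sup>2 * u n \<le> (\<mu>\<^sup>2 * M) * w n" for n
  proof -
    have "(\<mu> * (w n / u n))\<^sup>2 * u n = \<mu>\<^sup>2 * (w n / u n) * w n"
      using u[of n] by (simp add: power2_eq_square)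
    also have "\<dots> \<le> \<mu>\<^sup>2 * M * w n"
      using M(2)[of n] w[of n] by (intro mult_right_mono mult_left_mono) auto
    finally show ?thesis .
  qed
  note T = diagonal_operator_bound[of w u "\<lambda>n. \<mu> * (w n / u n)", OF w u this]
  define R where "R = (\<lambda>g. Abs_fps (\<lambda>n. complex_of_real (u n / (\<mu> * w n)) * fps_nth g n))"
  have "(u n / (\<mu> * w n))\<^sup>2 * w n \<le> (1 / (\<mu>\<^sup>2 * \<epsilon>)) * u n" for n
  proof -
    have "(u n / (\<mu> * w n))\<^sup>2 * w n = (u n / w n) * (u n / \<mu>\<^sup>2)"
      using w[of n] by (simp add: power2_eq_square)
    also have "\<dots> \<le> (1 / \<epsilon>) * (u n / \<mu>\<^sup>2)"
      using wu(1)[of n] \<epsilon>(1) w[of n] u[of n] by (intro mult_right_mono) (auto simp: field_simps)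
    finally show ?thesis by (simp add: mult_ac)
  qed
  note R = diagonal_operator_bound[of u w "\<lambda>n. u n / (\<mu> * w n)", OF u w this]
  have bij: "bij_betw T (weighted_hardy w) (weighted_hardy u)"
  proof (rule bij_betw_byWitness[where f' = R])
    show "\<forall>f\<in>weighted_hardy w. R (T f) = f" "\<forall>g\<in>weighted_hardy u. T (R g) = g"
      using w u \<mu> by (auto simp: T_def R_def fps_eq_iff less_imp_neq[symmetric])
  qed (use T(1) R(1) in \<open>auto simp: T_def R_def\<close>)
  have "wh_bounded_linear w u T"
    unfolding wh_bounded_linear_def
  proof (intro conjI)
    show "T ` weighted_hardy w \<subseteq> weighted_hardy u" using T(1) by (auto simp: T_def)
    show "\<exists>C. \<forall>f\<in>weighted_hardy w. wh_norm u (T f) \<le> C * wh_norm w f"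
      using T(2) unfolding T_def by blast
  qed (auto simp: T_def fps_eq_iff algebra_simps add_divide_distrib)
  moreover have "T (wh_kernel w s) = fps_const (complex_of_real \<mu>) * wh_kernel u s" for s
    using w u by (simp add: T_def fps_eq_iff wh_kernel_def field_simps less_imp_neq[symmetric])
  ultimately show "hfs_isomorphism w u T"
    unfolding hfs_isomorphism_def using bij \<mu>
    by (intro conjI exI[of _ "\<lambda>z. z"] exI[of _ "\<lambda>_. complex_of_real \<mu>"])
      (auto simp: bij_betw_def inj_on_def)
  \<comment> \<open>The inclusion is the diagonal operator with all entries 1, bounded because w_n
    <= M u_n.\<close>
  have "h \<in> weighted_hardy w" if "h \<in> weighted_hardy u" for h
  proof -
    have "h = Abs_fps (\<lambda>n. complex_of_real 1 * fps_nth h n)" by (rule fps_ext) simp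
    then show ?thesis
      using diagonal_operator_bound(1)[of u w "\<lambda>_. 1" M h, OF u w] wu(2) that by simp
  qed
  then have "is_wh_adjoint w u T (\<lambda>h. fps_const (complex_of_real \<mu>) * h)"
    unfolding is_wh_adjoint_def
  proof (intro conjI ballI)
    fix f h
    have "complex_of_real (\<mu> * (w n / u n)) * fps_nth f n * cnj (fps_nth h n) * complex_of_real (u n)
      = fps_nth f n * cnj (fps_nth (fps_const (complex_of_real \<mu>) * h) n) * complex_of_real (w n)" for n
      using u[of n] by simp
    then show "wh_inner u (T f) h = wh_inner w f (fps_const (complex_of_real \<mu>) * h)"
      by (simp only: wh_inner_def T_def fps_nth_Abs_fps)
  qed (auto intro!: W.scale_in_H)
  moreover have "eval_fps (fps_const (complex_of_real \<mu>) * h) z = complex_of_real \<mu> * eval_fps h z"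
    if "h \<in> weighted_hardy u" "z \<in> unit_disk" for h z
  proof -
    have "summable (\<lambda>n. fps_nth h n * z ^ n)"
      using hfs that unfolding hilbert_function_space_on_disk_def by blast
    then show ?thesis by (simp add: eval_fps_def mult.assoc suminf_mult)
  qed
  ultimately show "adjoint_is_composition w u T (complex_of_real \<mu>) (\<lambda>z. z)"
    unfolding adjoint_is_composition_def by blast
qed

lemma proportional_weights_equiv:
  assumes "c > 0" "\<And>n. w n / u n = c"
  shows "weights_equiv w u"
  unfolding weights_equiv_def using assms
  by (intro exI[of _ "c / 2"] exI[of _ "c + 1"] conjI) auto

lemma proportional_isometric:
  assumes w: "\<And>n. w n > 0" and u: "\<And>n. u n > 0" and hfs: "hilbert_function_space_on_disk u"
    and c: "c > 0" "\<And>n. w n / u n = c"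
  obtains T \<alpha> where "isometric_hfs_isomorphism w u T" "adjoint_is_composition w u T \<alpha> (\<lambda>z. z)"
proof -
  \<comment> \<open>With this choice \<open>T\<close> multiplies every coefficient by \<mu> c = sqrt
    c, exactly compensating w_n = c u_n.\<close>
  define \<mu> where "\<mu> = 1 / sqrt c"
  define T where "T = (\<lambda>f. Abs_fps (\<lambda>n. complex_of_real (\<mu> * (w n / u n)) * fps_nth f n))"
  have \<mu>: "\<mu> > 0" using c(1) by (simp add: \<mu>_def)
  note iso = diagonal_hfs_isomorphism[OF w u hfs proportional_weights_equiv[OF c] \<mu>, folded T_def]
  have "wh_norm u (T f) = wh_norm w f" for f
  proof -
    have wn: "w n = c * u n" for n using c(2)[of n] u[of n] by (simp add: field_simps)
    have "(\<mu> * c) * (\<mu> * c) = c" using c(1) by (simp add: \<mu>_def)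
    then have cc: "complex_of_real (\<mu> * c) * complex_of_real (\<mu> * c) = complex_of_real c"
      by (simp only: flip: of_real_mult)
    have "fps_nth (T f) n * cnj (fps_nth (T f) n) * complex_of_real (u n)
      = (complex_of_real (\<mu> * c) * complex_of_real (\<mu> * c))
        * (fps_nth f n * cnj (fps_nth f n) * complex_of_real (u n))" for n
      by (simp add: T_def c(2) mult_ac)
    then have "fps_nth (T f) n * cnj (fps_nth (T f) n) * complex_of_real (u n)
      = fps_nth f n * cnj (fps_nth f n) * complex_of_real (w n)" for n
      unfolding cc wn by (simp add: mult_ac)
    then show ?thesis by (simp only: wh_norm_def wh_inner_def)
  qed
  then show ?thesis using that[of T] iso unfolding isometric_hfs_isomorphism_def by blast
qed

section \<open>Rigidity\<close>

text \<open>The inverse of an isometric \<open>T\<close> is its adjoint, hence the weighted composition operator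
  \<open>h \<mapsto> cnj \<mu> \<cdot> (h \<circ> \<phi>)\<close>.\<close>

lemma isometric_proportional:
  assumes w: "\<And>n. w n > 0" "hilbert_function_space_on_disk w"
    and u: "\<And>n. u n > 0" "hilbert_function_space_on_disk u"
    and T: "isometric_hfs_isomorphism w u T"
  shows "\<exists>c>0. \<forall>n. w n / u n = c"
proof -
  interpret U: weighted_hardy_space u by standard (rule u)
  interpret W: weighted_hardy_space w by standard (rule w)
  obtain \<phi> \<mu> where \<phi>: "bij_betw \<phi> unit_disk unit_disk"
    and \<mu>: "\<And>s. s \<in> unit_disk \<Longrightarrow> \<mu> s \<noteq> 0"
    and ker: "\<And>s. s \<in> unit_disk \<Longrightarrow> T (wh_kernel w s) = fps_const (\<mu> s) * wh_kernel u (\<phi> s)"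
    using T unfolding isometric_hfs_isomorphism_def hfs_isomorphism_def by blast
  have bij: "bij_betw T W.H U.H" and norm: "\<And>f. f \<in> W.H \<Longrightarrow> U.nrm (T f) = W.nrm f"
    and T_in: "\<And>f. f \<in> W.H \<Longrightarrow> T f \<in> U.H"
    and T_add: "\<And>f g. f \<in> W.H \<Longrightarrow> g \<in> W.H \<Longrightarrow> T (f + g) = T f + T g"
    and T_scale: "\<And>c f. f \<in> W.H \<Longrightarrow> T (fps_const c * f) = fps_const c * T f"
    using T unfolding isometric_hfs_isomorphism_def hfs_isomorphism_def wh_bounded_linear_def by auto
  \<comment> \<open>Polarization: \<open>norm_add_sq\<close> expresses the real part of the inner
    product through norms, which \<open>T\<close> preserves.\<close>
  have Re_inner: "Re (U.inner (T f) (T g)) = Re (W.inner f g)" if fg: "f \<in> W.H" "g \<in> W.H" for f g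
    using U.norm_add_sq[OF T_in[OF fg(1)] T_in[OF fg(2)]] W.norm_add_sq[OF fg] fg
    by (simp add: norm W.add_in_H flip: T_add)
  have inner: "U.inner (T f) (T g) = W.inner f g" if fg: "f \<in> W.H" "g \<in> W.H" for f g
  proof (rule complex_eqI)
    show "Re (U.inner (T f) (T g)) = Re (W.inner f g)" by (rule Re_inner[OF fg])
    \<comment> \<open>Replacing g by i g multiplies the inner product by -i, whose real part is then
      the original imaginary part.\<close>
    show "Im (U.inner (T f) (T g)) = Im (W.inner f g)"
      using Re_inner[OF fg(1) W.scale_in_H[OF fg(2)], of \<i>] fg
      by (simp add: T_scale T_in U.inner_scale_right W.inner_scale_right)
  qed
  define \<psi> where "\<psi> = inv_into unit_disk \<phi>"
  have \<psi>: "bij_betw \<psi> unit_disk unit_disk" unfolding \<psi>_def by (rule bij_betw_inv_into[OF \<phi>])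
  have \<phi>\<psi>: "\<phi> (\<psi> z) = z" "\<psi> (\<phi> z) = z" if "z \<in> unit_disk" for z
    unfolding \<psi>_def using that \<phi> by (simp_all only: bij_betw_inv_into_right bij_betw_inv_into_left)
  note maps = bij_betw_imp_funcset[OF \<phi>] bij_betw_imp_funcset[OF \<psi>]
  note disk = funcset_mem[OF maps(1)] funcset_mem[OF maps(2)]
  \<comment> \<open>Evaluation at \<open>s\<close> is the inner product with the kernel;
    \<open>T\<close> preserves it and carries the kernel to \<mu>(s) times the kernel at \<phi>(s).
    Conjugate-linearity turns \<mu> into its conjugate.\<close>
  have eval: "eval_fps f s = cnj (\<mu> s) * eval_fps (T f) (\<phi> s)" if f: "f \<in> W.H" and s: "s \<in> unit_disk" for f s
  proof -
    have k: "wh_kernel w s \<in> W.H" "wh_kernel u (\<phi> s) \<in> U.H"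
      using wh_kernel_in_weighted_hardy[OF w s] wh_kernel_in_weighted_hardy[OF u disk(1)[OF s]] by auto
    have "eval_fps f s = U.inner (T f) (T (wh_kernel w s))"
      using wh_kernel_reproducing[of w f s, OF w(1)] inner[OF f k(1)] by simp
    also have "\<dots> = cnj (\<mu> s) * U.inner (T f) (wh_kernel u (\<phi> s))"
      unfolding ker[OF s] by (rule U.inner_scale_right[OF k(2) T_in[OF f]])
    finally show ?thesis by (simp add: wh_kernel_reproducing[of u, OF u(1)])
  qed
  let ?m = "\<lambda>s. cnj (\<mu> s)" and ?n = "\<lambda>z. 1 / cnj (\<mu> (\<psi> z))"
  have W: "wcomp w u ?m \<phi> 1"
    unfolding wcomp_def
  proof
    fix h assume "h \<in> U.H"
    then obtain f where "f \<in> W.H" "h = T f"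
      using bij_betw_imp_surj_on[OF bij] by (metis imageE)
    then show "\<exists>g\<in>W.H. (\<forall>z\<in>unit_disk. eval_fps g z = ?m z * eval_fps h (\<phi> z)) \<and> W.nrm g \<le> 1 * U.nrm h"
      using eval norm by (intro bexI[of _ f]) auto
  qed
  have U: "wcomp u w ?n \<psi> 1"
    unfolding wcomp_def
  proof
    fix f assume f: "f \<in> W.H"
    have "eval_fps (T f) z = ?n z * eval_fps f (\<psi> z)" if z: "z \<in> unit_disk" for z
      using eval[OF f disk(2)[OF z]] \<mu>[OF disk(2)[OF z]] \<phi>\<psi>(1)[OF z] by (simp add: field_simps)
    then show "\<exists>g\<in>U.H. (\<forall>z\<in>unit_disk. eval_fps g z = ?n z * eval_fps f (\<psi> z)) \<and> U.nrm g \<le> 1 * W.nrm f"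
      using f norm T_in by (intro bexI[of _ "T f"]) auto
  qed
  have mn: "?m z * ?n (\<phi> z) = 1" if "z \<in> unit_disk" for z
    using \<mu>[OF that] \<phi>\<psi>(2)[OF that] by simp
  obtain \<zeta> m n where \<zeta>: "cmod \<zeta> = 1"
    and W1: "wcomp w u m (\<lambda>z. \<zeta> * z) (1 * 1 * 1)"
    and U1: "wcomp u w n (\<lambda>z. cnj \<zeta> * z) (1 * 1 * 1)"
    and mn': "\<And>z. z \<in> unit_disk \<Longrightarrow> m z * n (\<zeta> * z) = 1"
    by (rule wcomp_reduce_to_rotation[OF u w W zero_le_one U zero_le_one maps \<phi>\<psi>(2,1)])
      (assumption | rule mn that)+
  have mn0: "m 0 * n 0 = 1" using mn'[of 0] by simp
  have m: "m z = m 0" and n: "n z = n 0" if "z \<in> unit_disk" for z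
  proof -
    note WU = W1[unfolded mult_1] U1[unfolded mult_1]
    show "m z = m 0"
      by (rule wcomp_contractive_rotation_const[OF u(1) w(1) WU mn0 that])
    show "n z = n 0"
      by (rule wcomp_contractive_rotation_const[OF w(1) u(1) WU(2,1) _ that])
        (use mn0 in \<open>simp only: mult.commute\<close>)
  qed
  \<comment> \<open>Since the modulus of \<open>n 0\<close> is 1 / a, the two contractive bounds on
    monomials squeeze to a sqrt (w k) = sqrt (u k) for every \<open>k\<close>.\<close>
  define a where "a = cmod (m 0)"
  have a: "a * cmod (n 0) = 1" "a > 0" using mn0 by (auto simp: a_def simp flip: norm_mult)
  have "w k / u k = 1 / a\<^sup>2" for k
  proof -
    have "a * sqrt (w k) \<le> sqrt (u k)"
      using wcomp_const_rotation_bound[OF u(1) w wcomp_cong[OF W1 m refl] \<zeta>, of k] by (simp add: a_def)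
    moreover have "cmod (n 0) * sqrt (u k) \<le> sqrt (w k)"
      using wcomp_const_rotation_bound[OF w(1) u wcomp_cong[OF U1 n refl], of k] \<zeta> by simp
    then have "a * (cmod (n 0) * sqrt (u k)) \<le> a * sqrt (w k)" using a(2) by simp
    then have "sqrt (u k) \<le> a * sqrt (w k)" using a(1) by (simp flip: mult.assoc)
    ultimately have "(sqrt (u k))\<^sup>2 = (a * sqrt (w k))\<^sup>2" by simp
    then have "u k = a\<^sup>2 * w k"
      using w(1)[of k] u(1)[of k] by (simp add: power_mult_distrib)
    then show ?thesis using w(1)[of k] a(2) by simp
  qed
  then show ?thesis using a(2) by (intro exI[of _ "1 / a\<^sup>2"]) simp
qed

text \<open>Here the adjoint \<open>S\<close> has upper and lower bounds and is onto, so
  \<open>\<alpha>\<close> C_\<phi> and its inverse are both bounded weighted composition operators.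
  Their constant multipliers survive the reduction to a rotation, and monomials give the two
  bounds.\<close>

lemma composition_adjoint_weights_equiv:
  assumes w: "\<And>n. w n > 0" "hilbert_function_space_on_disk w"
    and u: "\<And>n. u n > 0" "hilbert_function_space_on_disk u"
    and T: "hfs_isomorphism w u T" and \<phi>: "bij_betw \<phi> unit_disk unit_disk"
    and adj: "adjoint_is_composition w u T \<alpha> \<phi>"
  shows "weights_equiv w u"
proof -
  obtain S where S: "is_wh_adjoint w u T S"
    "\<And>h z. h \<in> weighted_hardy u \<Longrightarrow> z \<in> unit_disk \<Longrightarrow> eval_fps (S h) z = \<alpha> * eval_fps h (\<phi> z)"
    using adj unfolding adjoint_is_composition_def by blast
  interpret adjoint_bijection w u T S
    using T S(1) by unfold_locales (auto simp: w u hfs_isomorphism_def)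
  obtain C where C: "C > 0" "\<And>h. h \<in> U.H \<Longrightarrow> W.nrm (S h) \<le> C * U.nrm h"
    by (rule bounded_S) blast
  obtain c where c: "c > 0" "\<And>h. h \<in> U.H \<Longrightarrow> c * U.nrm h \<le> W.nrm (S h)"
    using S_bounded_below by blast
  have one: "1 \<in> U.H" "U.nrm 1 > 0"
    using U.monom_in_H[of 1 0] U.norm_monom[of 1 0] u(1)[of 0] by simp_all
  \<comment> \<open>If \<alpha> were 0, then \<open>S\<close> would annihilate the constant 1,
    against its lower bound.\<close>
  have \<alpha>: "\<alpha> \<noteq> 0"
  proof
    assume "\<alpha> = 0"
    then have "S 1 = 0"
      by (intro hfs_eval_inject[OF w(2) S_in[OF one(1)] W.zero_in_H]) (simp add: S(2) one(1))
    then show False using c(2)[OF one(1)] c(1) one(2) by (simp add: W.norm_zero mult_le_0_iff)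
  qed
  define \<psi> where "\<psi> = inv_into unit_disk \<phi>"
  have \<psi>: "bij_betw \<psi> unit_disk unit_disk" unfolding \<psi>_def by (rule bij_betw_inv_into[OF \<phi>])
  have \<phi>\<psi>: "\<phi> (\<psi> z) = z" "\<psi> (\<phi> z) = z" if "z \<in> unit_disk" for z
    unfolding \<psi>_def using that \<phi> by (simp_all only: bij_betw_inv_into_right bij_betw_inv_into_left)
  note maps = bij_betw_imp_funcset[OF \<phi>] bij_betw_imp_funcset[OF \<psi>]
  have W: "wcomp w u (\<lambda>_. \<alpha>) \<phi> C"
    unfolding wcomp_def using S_in S(2) C(2) by blast
  have U: "wcomp u w (\<lambda>_. 1 / \<alpha>) \<psi> (1 / c)"
    unfolding wcomp_def
  proof
    fix g assume "g \<in> W.H"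
    then obtain h where h: "h \<in> U.H" "S h = g" by (rule S_surj)
    have "eval_fps h z = 1 / \<alpha> * eval_fps g (\<psi> z)" if z: "z \<in> unit_disk" for z
      using S(2)[OF h(1) funcset_mem[OF maps(2) z]] \<phi>\<psi>(1)[OF z] \<alpha> h(2) by simp
    moreover have "U.nrm h \<le> 1 / c * W.nrm g"
      using c(1) c(2)[OF h(1)] h(2) by (simp add: field_simps)
    ultimately show "\<exists>h\<in>U.H. (\<forall>z\<in>unit_disk. eval_fps h z = 1 / \<alpha> * eval_fps g (\<psi> z))
        \<and> U.nrm h \<le> 1 / c * W.nrm g"
      using h(1) by blast
  qed
  have Cc: "0 \<le> C" "0 \<le> 1 / c" "\<alpha> * (1 / \<alpha>) = 1" using C(1) c(1) \<alpha> by simp_all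
  obtain \<zeta> m n where \<zeta>: "cmod \<zeta> = 1"
    and W1: "wcomp w u m (\<lambda>z. \<zeta> * z) (C * (1 / c) * C)"
    and U1: "wcomp u w n (\<lambda>z. cnj \<zeta> * z) (1 / c * C * (1 / c))"
    and mn: "\<And>z. z \<in> unit_disk \<Longrightarrow> m z * n (\<zeta> * z) = 1"
    and "\<And>z. z \<in> unit_disk \<Longrightarrow> \<exists>x\<in>unit_disk. \<exists>y\<in>unit_disk. m z = \<alpha> * (1 / \<alpha>) * \<alpha>"
    using wcomp_reduce_to_rotation[OF u w W Cc(1) U Cc(2) maps \<phi>\<psi>(2,1) Cc(3)] by blast
  \<comment> \<open>The composite multiplier is \<alpha> (1 / \<alpha>) \<alpha>.\<close>
  then have m: "m z = \<alpha>" if "z \<in> unit_disk" for z using that \<alpha> by auto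
  have n: "n z = 1 / \<alpha>" if z: "z \<in> unit_disk" for z
  proof -
    have "cnj \<zeta> * z \<in> unit_disk" using z \<zeta> by (simp add: norm_mult)
    moreover have "\<zeta> * (cnj \<zeta> * z) = z"
      using complex_norm_square[of \<zeta>] \<zeta> by (simp flip: mult.assoc)
    ultimately have "\<alpha> * n z = 1" using mn[of "cnj \<zeta> * z"] m[of "cnj \<zeta> * z"] by metis
    then show ?thesis using \<alpha> by (simp add: eq_divide_eq mult.commute)
  qed
  have \<zeta>': "cmod (cnj \<zeta>) = 1" using \<zeta> by simp
  \<comment> \<open>\<open>A\<close> and \<open>B\<close> are the operator bounds divided by the
    moduli of the multipliers; they bound sqrt (w_k / u_k) and sqrt (u_k / w_k).\<close>
  define A where "A = C * (1 / c) * C / cmod \<alpha>"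
  define B where "B = 1 / c * C * (1 / c) * cmod \<alpha>"
  have AB: "A > 0" "B > 0" using C(1) c(1) \<alpha> by (simp_all add: A_def B_def)
  have le: "w k \<le> A\<^sup>2 * u k" "u k \<le> B\<^sup>2 * w k" for k
  proof -
    have "cmod \<alpha> * sqrt (w k) \<le> C * (1 / c) * C * sqrt (u k)"
      by (rule wcomp_const_rotation_bound[OF u(1) w wcomp_cong[OF W1 m refl] \<zeta>])
    also have "\<dots> = cmod \<alpha> * (A * sqrt (u k))" using \<alpha> by (simp add: A_def)
    finally have "sqrt (w k) \<le> A * sqrt (u k)" using \<alpha> by simp
    then have "(sqrt (w k))\<^sup>2 \<le> (A * sqrt (u k))\<^sup>2" by (rule power_mono) (simp add: W.nonneg)
    then show "w k \<le> A\<^sup>2 * u k" by (simp add: power_mult_distrib W.nonneg U.nonneg)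
    have "cmod (1 / \<alpha>) * sqrt (u k) \<le> 1 / c * C * (1 / c) * sqrt (w k)"
      by (rule wcomp_const_rotation_bound[OF w(1) u wcomp_cong[OF U1 n refl] \<zeta>'])
    then have "cmod \<alpha> * (cmod (1 / \<alpha>) * sqrt (u k)) \<le> cmod \<alpha> * (1 / c * C * (1 / c) * sqrt (w k))"
      by (rule mult_left_mono) simp
    then have "sqrt (u k) \<le> B * sqrt (w k)"
      using \<alpha> by (simp add: B_def norm_divide mult_ac)
    then have "(sqrt (u k))\<^sup>2 \<le> (B * sqrt (w k))\<^sup>2" by (rule power_mono) (simp add: U.nonneg)
    then show "u k \<le> B\<^sup>2 * w k" by (simp add: power_mult_distrib W.nonneg U.nonneg)
  qed
  \<comment> \<open>Adding 1 produces the strict inequalities in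
    \<open>weights_equiv\<close>.\<close>
  have "1 / (B\<^sup>2 + 1) < w k / u k \<and> w k / u k < A\<^sup>2 + 1" for k
  proof
    have "u k < (B\<^sup>2 + 1) * w k" using le(2)[of k] w(1)[of k] by (simp add: algebra_simps)
    moreover have "B\<^sup>2 + 1 > 0" by (simp add: add_nonneg_pos)
    ultimately show "1 / (B\<^sup>2 + 1) < w k / u k" using u(1)[of k] by (simp add: divide_simps mult.commute)
    have "w k < (A\<^sup>2 + 1) * u k" using le(1)[of k] u(1)[of k] by (simp add: algebra_simps)
    then show "w k / u k < A\<^sup>2 + 1" using u(1)[of k] by (simp add: divide_simps)
  qed
  moreover have "1 / (B\<^sup>2 + 1) > 0" "A\<^sup>2 + 1 > 0" by (simp_all add: add_nonneg_pos)
  ultimately show ?thesis unfolding weights_equiv_def by blast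
qed

theorem theorem1p2:
  fixes w u :: "nat \<Rightarrow> real"
  assumes "\<And>n. w n > 0" and "\<And>n. u n > 0"
    and "hilbert_function_space_on_disk w" and "hilbert_function_space_on_disk u"
  shows "(weights_equiv w u \<longrightarrow>
            hfs_isomorphic w u \<and>
            ((\<exists>T. isometric_hfs_isomorphism w u T) \<longleftrightarrow> (\<exists>c>0. \<forall>n. w n / u n = c))) \<and>
         ((\<exists>T \<alpha> \<phi>. hfs_isomorphism w u T \<and> bij_betw \<phi> unit_disk unit_disk \<and>
                    adjoint_is_composition w u T \<alpha> \<phi>) \<longrightarrow>
            weights_equiv w u \<and>
            ((\<exists>T \<alpha> \<phi>. isometric_hfs_isomorphism w u T \<and> bij_betw \<phi> unit_disk unit_disk \<and>
                       adjoint_is_composition w u T \<alpha> \<phi>) \<longleftrightarrow> (\<exists>c>0. \<forall>n. w n / u n = c)))"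
proof -
  note w = assms(1,3) and u = assms(2,4)
  \<comment> \<open>One isometry, with the identity as symbol of its adjoint, gives the converse
    direction in both parts.\<close>
  have proportional: "\<exists>T \<alpha> \<phi>. isometric_hfs_isomorphism w u T \<and> bij_betw \<phi> unit_disk unit_disk \<and>
      adjoint_is_composition w u T \<alpha> \<phi>" if c: "c > 0" "\<And>n. w n / u n = c" for c
  proof -
    obtain T \<alpha> where "isometric_hfs_isomorphism w u T" "adjoint_is_composition w u T \<alpha> (\<lambda>z. z)"
      by (rule proportional_isometric[of w u c, OF w(1) u c])
    moreover have "bij_betw (\<lambda>z. z) unit_disk unit_disk" by (simp add: bij_betw_def inj_on_def)
    ultimately show ?thesis by blast
  qed
  \<comment> \<open>This covers the forward direction in both parts, whatever form the adjoint
    takes.\<close>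
  have iso: "\<exists>c>0. \<forall>n. w n / u n = c" if "isometric_hfs_isomorphism w u T" for T
    by (rule isometric_proportional[OF w u that])
  have "hfs_isomorphic w u" if "weights_equiv w u"
    unfolding hfs_isomorphic_def
    by (rule exI) (rule diagonal_hfs_isomorphism(1)[of w u 1, OF w(1) u that zero_less_one])
  moreover have "weights_equiv w u"
    if "hfs_isomorphism w u T" "bij_betw \<phi> unit_disk unit_disk" "adjoint_is_composition w u T \<alpha> \<phi>" for T \<alpha> \<phi>
    by (rule composition_adjoint_weights_equiv[OF w u that])
  ultimately show ?thesis using proportional iso by blast
qed

end
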